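(* Every graph with at most $14$ vertices and odd-girth at least $7$ admits a homomorphism to the cycle $C_5$. Consequently, $\eta(3,2)=15$.
   Context: All graphs are finite and simple. The odd-girth of a graph is the length of its shortest odd cycle (a graph with no odd cycle has infinite odd-girth). $C_n$ denotes the cycle of length $n$. A homomorphism from $G$ to $H$ is a map $V(G)\to V(H)$ sending adjacent vertices to adjacent vertices. For positive integers $k,l$, $\eta(k,l)$ denotes the smallest number of vertices of a graph of odd-girth $2k+1$ that admits no homomorphism to $C_{2l+1}$. *)

theory Defs
  imports "Graph_Theory.Graph_Theory" "HOL-Library.Extended_Nat"
begin

text \<open>
  A finite simple graph is a \<^locale>\<open>pair_graph\<close>: a finite, loop-free, symmetric digraph without
  parallel arcs, so that the undirected edge \<open>uv\<close> is the pair of arcs \<open>(u, v)\<close>, \<open>(v, u)\<close>.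
\<close>

text \<open>
  In a symmetric digraph the closed walk \<open>u, v, u\<close> counts as a \<^const>\<open>pre_digraph.cycle\<close>, but it
  has even length; in a loop-free graph the cycles of odd length are exactly the usual
  odd cycles of length at least 3. The infimum is \<open>\<infinity>\<close> if there is no odd cycle.
\<close>
definition odd_girth :: "'a pair_pre_digraph \<Rightarrow> enat" where
  "odd_girth G = Inf {enat (length p) | p. pre_digraph.cycle (with_proj G) p \<and> odd (length p)}"

definition cycle_graph :: "nat \<Rightarrow> nat pair_pre_digraph" where
  "cycle_graph n =
     \<lparr>pverts = {0..<n},
      parcs = {(i, j). i < n \<and> j < n \<and> (j = Suc i mod n \<or> i = Suc j mod n)}\<rparr>"

lemma pair_graph_cycle_graph:
  assumes "3 \<le> n"
  shows "pair_graph (cycle_graph n)"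
proof
  have "parcs (cycle_graph n) \<subseteq> {0..<n} \<times> {0..<n}"
    by (auto simp: cycle_graph_def)
  then show "finite (parcs (cycle_graph n))"
    by (rule finite_subset) simp
  have "Suc i mod n \<noteq> i" if "i < n" for i
    using assms that by (cases "Suc i = n") auto
  then show "fst e \<noteq> snd e" if "e \<in> parcs (cycle_graph n)" for e
    using that by (fastforce simp: cycle_graph_def)
qed (auto simp: cycle_graph_def symmetric_def sym_def)

definition graph_hom :: "('a \<Rightarrow> 'b) \<Rightarrow> 'a pair_pre_digraph \<Rightarrow> 'b pair_pre_digraph \<Rightarrow> bool" where
  "graph_hom h G H \<longleftrightarrow>
     (\<forall>v \<in> pverts G. h v \<in> pverts H) \<and> (\<forall>(u, v) \<in> parcs G. (h u, h v) \<in> parcs H)"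

definition admits_hom :: "'a pair_pre_digraph \<Rightarrow> 'b pair_pre_digraph \<Rightarrow> bool" where
  "admits_hom G H \<longleftrightarrow> (\<exists>h. graph_hom h G H)"

text \<open>
  Every finite graph is isomorphic to one whose vertices are natural numbers, so ranging over
  graphs on \<^typ>\<open>nat\<close> loses nothing. A nonempty set of extended naturals attains its infimum; the
  value is \<open>\<infinity>\<close> exactly if no such graph exists.
\<close>
definition eta :: "nat \<Rightarrow> nat \<Rightarrow> enat" where
  "eta k l = Inf {enat (card (pverts G)) | G :: nat pair_pre_digraph.
     pair_graph G \<and> odd_girth G = enat (2 * k + 1) \<and> \<not> admits_hom G (cycle_graph (2 * l + 1))}"

end

theory Submission
  imports Defs
begin

text \<open>
  Suppose \<open>G\<close> has no closed walk of length 1, 3 or 5 and is not \<open>C\<^sub>5\<close>-colourable. If \<open>G - N[v]\<close>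
  were bipartite, colouring \<open>N(v)\<close> by 0, the vertices adjacent to \<open>N(v)\<close> by 1 or 4 and all others
  by 3 or 2, according to their side, would be a homomorphism to \<open>C\<^sub>5\<close>. Hence for every \<open>v\<close> a
  shortest odd cycle \<open>Z\<close> of \<open>G - N[v]\<close> exists; it is chordless and has length \<open>m \<ge> 7\<close>. Take \<open>v\<close> of
  maximum degree \<open>d\<close>. If \<open>d \<le> 2\<close>, then \<open>Z\<close> is a component and at most 7 vertices remain, too few for
  an odd cycle avoiding a closed neighbourhood. Otherwise \<open>m + d \<le> 13\<close> leaves \<open>m = 7\<close> with
  \<open>3 \<le> d \<le> 6\<close> and \<open>m = 9\<close> with \<open>3 \<le> d \<le> 4\<close>. No two vertices adjacent to \<open>N(v)\<close> are adjacent, so for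
  \<open>m = 7\<close> a rotation confines those on \<open>Z\<close> to positions 0, 2 and 4. Each of the six cases is then a
  propositional contradiction between the absence of short odd cycles, the degree bound, and the
  failure of suitably chosen colourings.
\<close>

section \<open>Odd cycles avoiding a closed neighbourhood\<close>

text \<open>The obstacle is the hypothesis that no map is a homomorphism: on 14 labelled vertices it
  ranges over 5^14 colourings. Fixing a chordless cycle and a star that avoids it decides many pairs
  of vertices in advance, and then a moderate list of colourings suffices. Taking the star at a
  vertex of maximum degree balances the cases: a large star leaves few vertices over, and a small
  one, which leaves more, bounds all degrees by the same small number. The bound 14 enters through
  disjointness: the cycle, \<open>v\<close> and its neighbours occupy \<open>m + 1 + d\<close>
  vertices. Odd-girth is treated through closed walks, that is, powers of the adjacency relation.
  These can be concatenated, reversed and mapped along homomorphisms without any concern for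
  repeated vertices, and a shortest odd closed walk is automatically a chordless cycle. There is no
  induction on the number of vertices: a smaller graph is padded with isolated vertices until it has
  exactly 14.\<close>

definition C5_adj :: "nat \<Rightarrow> nat \<Rightarrow> bool" where
  "C5_adj i j \<longleftrightarrow> (i, j) \<in> parcs (cycle_graph 5)"

lemma C5_adj_iff:
  "C5_adj i j \<longleftrightarrow> i < 5 \<and> j < 5 \<and> (j = Suc i mod 5 \<or> i = Suc j mod 5)"
  by (auto simp: C5_adj_def cycle_graph_def)

lemma C5_adj_sym: "C5_adj i j \<Longrightarrow> C5_adj j i"
  by (auto simp: C5_adj_iff)

section \<open>Odd closed walks, 2-colourings and shortest odd cycles\<close>

lemma relpowp_sym: "symp E \<Longrightarrow> (E ^^ n) x y \<Longrightarrow> (E ^^ n) y x"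
proof (induction n arbitrary: y)
  case (Suc n)
  from Suc.prems(2) obtain z where z: "(E ^^ n) x z" "E z y" by (rule relpowp_Suc_E)
  then have "E y z" "(E ^^ n) z x" using Suc sympD by fast+
  then show ?case by (rule relpowp_Suc_I2)
qed simp

lemma relpowp_map:
  assumes "\<And>x y. R x y \<Longrightarrow> E (f x) (f y)" "(R ^^ n) x y"
  shows "(E ^^ n) (f x) (f y)"
  using assms(2)
proof (induction n arbitrary: y)
  case (Suc n)
  from Suc.prems obtain z where "(R ^^ n) x z" "R z y" by (rule relpowp_Suc_E)
  then show ?case using Suc.IH assms(1) relpowp_Suc_I by fast
qed simp

text \<open>The colour of a vertex is the parity of a walk that reaches it from a chosen
  representative of its component. Ambiguous parity, or equal parity at the two ends of an edge,
  would produce an odd closed walk.\<close>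

lemma two_colouring:
  assumes "symp E" and odd: "\<And>n x. odd n \<Longrightarrow> \<not> (E ^^ n) x x"
  shows "\<exists>f :: 'a \<Rightarrow> bool. \<forall>x y. E x y \<longrightarrow> f x \<noteq> f y"
proof (intro exI allI impI)
  define r where "r x = (SOME y. E\<^sup>*\<^sup>* y x)" for x
  define f where "f x \<longleftrightarrow> (\<exists>n. even n \<and> (E ^^ n) (r x) x)" for x
  have r: "\<exists>n. (E ^^ n) (r x) x" for x
    unfolding r_def by (rule someI2[of _ x]) (simp_all add: rtranclp_imp_relpowp)
  fix x y assume xy: "E x y"
  have yx: "E y x" using xy \<open>symp E\<close> by (auto dest: sympD)
  have "E\<^sup>*\<^sup>* z x \<longleftrightarrow> E\<^sup>*\<^sup>* z y" for z
    using xy yx by (meson rtranclp.rtrancl_into_rtrancl)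
  \<comment> \<open>The predicates under \<open>SOME\<close> are equal for \<open>x\<close> and
    \<open>y\<close>, so the same representative is chosen for both.\<close>
  then have rr: "r y = r x" unfolding r_def by simp
  have parity: "even m \<longleftrightarrow> odd n" if "(E ^^ m) (r x) x" "(E ^^ n) (r x) y" for m n
  proof (rule ccontr)
    assume "\<not> ?thesis"
    \<comment> \<open>Out to \<open>x\<close>, across the edge and back from \<open>y\<close>: a
      closed walk, of odd length if \<open>m\<close> and \<open>n\<close> have the same
      parity.\<close>
    moreover have "(E ^^ (Suc m + n)) (r x) (r x)"
      using that xy \<open>symp E\<close> by (meson relpowp_Suc_I relpowp_sym relpowp_trans)
    ultimately show False using odd[of "Suc m + n" "r x"] by auto
  qed
  show "f x \<noteq> f y"
    unfolding f_def rr using parity r[of x] r[of y, unfolded rr] by blast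
qed

text \<open>A shortest odd closed walk works: a repeated vertex or a chord splits it into two closed
  walks, exactly one of which is odd, and minimality forbids that one to be shorter. Loops are not
  excluded here, so the adjacency formula has to be correct for \<open>m = 1\<close> too.\<close>

lemma chordless_odd_cycle:
  assumes sym: "symp E" and ex: "\<exists>n x. odd n \<and> (E ^^ n) x x"
  obtains m c where "odd m" "inj_on c {..<m}"
    "\<And>i j. i < m \<Longrightarrow> j < m \<Longrightarrow> E (c i) (c j) \<longleftrightarrow> j = Suc i mod m \<or> i = Suc j mod m"
    "(E ^^ m) (c 0) (c 0)" "\<And>n x. odd n \<Longrightarrow> (E ^^ n) x x \<Longrightarrow> m \<le> n"
proof -
  define m where "m = (LEAST n. odd n \<and> (\<exists>x. (E ^^ n) x x))"
  have "odd m \<and> (\<exists>x. (E ^^ m) x x)"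
    unfolding m_def by (rule LeastI_ex) (use ex in blast)
  then obtain x where m: "odd m" "(E ^^ m) x x" by blast
  have least: "m \<le> n" if "odd n" "(E ^^ n) y y" for n y
    unfolding m_def by (rule Least_le) (use that in blast)
  obtain c where c: "c 0 = x" "c m = x" "\<And>i. i < m \<Longrightarrow> E (c i) (c (Suc i))"
    using m(2) unfolding relpowp_fun_conv by blast
  have seg: "(E ^^ (j - i)) (c i) (c j)" if "i \<le> j" "j \<le> m" for i j
    unfolding relpowp_fun_conv
    by (rule exI[of _ "\<lambda>k. c (i + k)"]) (use that c(3) in auto)
  have outer: "(E ^^ (i + (m - j))) (c j) (c i)" if "i \<le> m" "j \<le> m" for i j
    using relpowp_trans[of "m - j" E "c j" x i "c i"] seg[of j m] seg[of 0 i] that c(1,2)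
    by (simp add: add.commute)
  have neq: "c i \<noteq> c j" if "i < j" "j < m" for i j
  proof
    assume eq: "c i = c j"
    have "(E ^^ (j - i)) (c i) (c i)" "(E ^^ (i + (m - j))) (c i) (c i)"
      using seg[of i j] outer[of i j] that eq by auto
    moreover have "odd (j - i) \<or> odd (i + (m - j))"
      using m(1) that by presburger
    ultimately show False using least that by fastforce
  qed
  have chord: "j = Suc i \<or> i = 0 \<and> Suc j = m" if "i < j" "j < m" "E (c i) (c j)" for i j
  proof -
    have "E (c j) (c i)" using that sym by (auto dest: sympD)
    then have "(E ^^ Suc (j - i)) (c i) (c i)" "(E ^^ Suc (i + (m - j))) (c j) (c j)"
      using seg[of i j] outer[of i j] that relpowp_Suc_I by force+
    \<comment> \<open>The edge closes both arcs, so the two lengths add up to \<open>m + 2\<close>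
      and one is odd. By minimality that one is at least \<open>m\<close>, which leaves an arc of
      length at most 1 on the other side: the edge joins consecutive vertices.\<close>
    moreover have "odd (Suc (j - i)) \<or> odd (Suc (i + (m - j)))"
      using m(1) that by presburger
    ultimately have "m \<le> Suc (j - i) \<or> m \<le> Suc (i + (m - j))"
      using least by blast
    then show ?thesis using that by linarith
  qed
  have step: "E (c i) (c (Suc i mod m))" if "i < m" for i
    using c(3)[OF that] that c(1,2) by (cases "Suc i = m") auto
  show thesis
  proof
    show "odd m" by fact
    show "inj_on c {..<m}"
      by (rule linorder_inj_onI) (use neq in auto)
    show "(E ^^ m) (c 0) (c 0)" using m c by simp
    show "m \<le> n" if "odd n" "(E ^^ n) y y" for n y using least that .
    fix i j assume ij: "i < m" "j < m"
    have loop: "m = 1" if "E (c i) (c i)"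
      using least[of 1 "c i"] that m(1) by (cases m) auto
    show "E (c i) (c j) \<longleftrightarrow> j = Suc i mod m \<or> i = Suc j mod m"
    proof
      assume "E (c i) (c j)"
      then consider "i = j" "m = 1" | "i < j" "E (c i) (c j)" | "j < i" "E (c j) (c i)"
        using loop sym by (metis linorder_neqE_nat sympD)
      then show "j = Suc i mod m \<or> i = Suc j mod m"
        by cases (use chord[of i j] chord[of j i] ij in auto)
    next
      assume "j = Suc i mod m \<or> i = Suc j mod m"
      then show "E (c i) (c j)" using step ij sym by (auto dest: sympD)
    qed
  qed
qed

text \<open>No range condition is imposed on \<open>h\<close>: \<open>C5_adj\<close> forces the
  colours at both ends of an edge below 5, and only isolated vertices may receive other
  values.\<close>

definition C5_colourable :: "('a \<Rightarrow> 'a \<Rightarrow> bool) \<Rightarrow> bool" where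
  "C5_colourable E \<longleftrightarrow> (\<exists>h. \<forall>x y. E x y \<longrightarrow> C5_adj (h x) (h y))"

text \<open>\<open>V\<close> only has to contain the endpoints of the edges. It may include isolated
  vertices, which makes padding to 14 elements possible. Stating everything for a relation, not a
  fixed graph, also allows the locale to be interpreted for a subgraph.\<close>

locale non_C5_colourable =
  fixes E :: "'a \<Rightarrow> 'a \<Rightarrow> bool" and V :: "'a set"
  assumes sym: "symp E"
    and no_short: "n \<in> {1, 3, 5} \<Longrightarrow> \<not> (E ^^ n) x x"
    and in_V: "E x y \<Longrightarrow> x \<in> V"
    and finite_V: "finite V"
    and not_colourable: "\<not> C5_colourable E"
begin

lemma symD: "E x y \<Longrightarrow> E y x"
  using sym by (rule sympD)

lemma irrefl: "\<not> E x x"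
  using no_short[of 1 x] by auto

lemma no_triangle: "E x y \<Longrightarrow> E y z \<Longrightarrow> \<not> E z x"
  using no_short[of 3 x] by (auto simp: numeral_3_eq_3)

lemma no_pentagon: "E x y \<Longrightarrow> E y z \<Longrightarrow> E z u \<Longrightarrow> E u w \<Longrightarrow> \<not> E w x"
  using no_short[of 5 x] by (simp add: eval_nat_numeral OO_def) blast

lemma odd_cycle_avoiding:
  obtains m c where "odd m" "7 \<le> m" "inj_on c {..<m}"
    "\<And>i j. i < m \<Longrightarrow> j < m \<Longrightarrow> E (c i) (c j) \<longleftrightarrow> j = Suc i mod m \<or> i = Suc j mod m"
    "c ` {..<m} \<subseteq> V - insert v {y. E v y}"
proof -
  \<comment> \<open>Removing the neighbours of \<open>v\<close> leaves \<open>v\<close> isolated, so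
    every vertex on an edge of \<open>R\<close> lies outside the closed neighbourhood.\<close>
  define R where "R x y \<longleftrightarrow> E x y \<and> \<not> E v x \<and> \<not> E v y" for x y
  have "symp R" using symD unfolding R_def by (auto intro!: sympI)
  have ex: "\<exists>n x. odd n \<and> (R ^^ n) x x"
  proof (rule ccontr)
    assume none: "\<not> ?thesis"
    have "\<exists>f :: 'a \<Rightarrow> bool. \<forall>x y. R x y \<longrightarrow> f x \<noteq> f y"
      by (rule two_colouring[OF \<open>symp R\<close>]) (use none in blast)
    then obtain f :: "'a \<Rightarrow> bool" where f: "\<And>x y. R x y \<Longrightarrow> f x \<noteq> f y" by blast
    define N where "N x \<longleftrightarrow> (\<exists>a. E v a \<and> E a x)" for x
    \<comment> \<open>One side of the bipartition uses 1 and 3, the other 4 and 2. Of the four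
      combinations only 1 with 4 is not adjacent in the 5-cycle, and it would need an edge between
      two vertices that both have neighbours in \<open>N(v)\<close>, hence a closed walk of length 5
      through \<open>v\<close>.\<close>
    define h :: "'a \<Rightarrow> nat" where "h x =
      (if E v x then 0 else if N x then if f x then 1 else 4 else if f x then 3 else 2)" for x
    have "C5_adj (h x) (h y)" if xy: "E x y" for x y
    proof -
      have "\<not> (E v x \<and> E v y)" using no_triangle[of v x y] symD xy by blast
      moreover have "E v x \<longrightarrow> N y" "E v y \<longrightarrow> N x" using xy symD unfolding N_def by blast+
      moreover have "\<not> (N x \<and> N y)"
        using no_pentagon[OF _ _ xy] symD unfolding N_def by blast
      moreover have "\<not> E v x \<and> \<not> E v y \<longrightarrow> f x \<noteq> f y" using f xy unfolding R_def by blast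
      ultimately show ?thesis unfolding h_def C5_adj_iff by auto
    qed
    then show False using not_colourable unfolding C5_colourable_def by blast
  qed
  obtain m c where c: "odd m" "inj_on c {..<m}"
    "\<And>i j. i < m \<Longrightarrow> j < m \<Longrightarrow> R (c i) (c j) \<longleftrightarrow> j = Suc i mod m \<or> i = Suc j mod m"
    "(R ^^ m) (c 0) (c 0)"
    by (rule chordless_odd_cycle[OF \<open>symp R\<close> ex]) blast
  have "(E ^^ n) x y" if "(R ^^ n) x y" for n x y
    by (rule relpowp_map[of R E "\<lambda>x. x", OF _ that]) (simp add: R_def)
  then have "m \<notin> {1, 3, 5}" using c(4) no_short by blast
  then have "7 \<le> m" using c(1) by simp presburger
  have R: "R (c i) (c (Suc i mod m))" if "i < m" for i
    using c(3)[of i "Suc i mod m"] that by auto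
  show thesis
  proof
    show "c ` {..<m} \<subseteq> V - insert v {y. E v y}"
      using R in_V unfolding R_def by blast
    \<comment> \<open>\<open>R\<close> agrees with \<open>E\<close> outside \<open>N(v)\<close>,
      where all \<open>c i\<close> lie, so chordlessness carries over from \<open>R\<close> to
      \<open>E\<close>.\<close>
    show "E (c i) (c j) \<longleftrightarrow> j = Suc i mod m \<or> i = Suc j mod m" if "i < m" "j < m" for i j
      using c(3)[OF that] R[of i] R[of j] that unfolding R_def by blast
  qed fact+
qed

lemma ex_degree_ge_3:
  assumes "card V \<le> 14"
  shows "\<exists>x\<in>V. 3 \<le> card {y. E x y}"
proof (rule ccontr)
  assume small: "\<not> ?thesis"
  have fin: "finite {y. E x y}" for x
    by (rule finite_subset[OF _ finite_V]) (use in_V symD in auto)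
  have "{y. E x y} = {}" if "x \<notin> V" for x using that in_V by auto
  then have deg: "card {y. E x y} \<le> 2" for x
    using small by (cases "x \<in> V") (auto simp: not_le)
  obtain m c where c: "odd m" "7 \<le> m" "inj_on c {..<m}" "c ` {..<m} \<subseteq> V"
    "\<And>i j. i < m \<Longrightarrow> j < m \<Longrightarrow> E (c i) (c j) \<longleftrightarrow> j = Suc i mod m \<or> i = Suc j mod m"
    \<comment> \<open>Any vertex may serve here: only a chordless odd cycle of length at least 7
      inside \<open>V\<close> is wanted.\<close>
    by (rule odd_cycle_avoiding[of undefined]) blast
  let ?Z = "c ` {..<m}"
  \<comment> \<open>The two neighbours along the cycle are distinct and already exhaust the degree
    2, so no edge leaves the cycle.\<close>
  have closed: "y \<in> ?Z" if xy: "x \<in> ?Z" "E x y" for x y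
  proof -
    obtain i where i: "i < m" "x = c i" using xy by auto
    define j where "j = (if i = 0 then m - 1 else i - 1)"
    have j: "j < m" "Suc j mod m = i" using i c(2) by (auto simp: j_def)
    have k: "Suc i mod m < m" "Suc i mod m \<noteq> j" using i c(2) by (auto simp: j_def mod_Suc)
    then have "c (Suc i mod m) \<noteq> c j" using c(3) j by (auto dest: inj_onD)
    then have "card {c (Suc i mod m), c j} = 2" by simp
    moreover have "{c (Suc i mod m), c j} \<subseteq> {y. E x y}"
      using c(5) i j k by auto
    ultimately have "{c (Suc i mod m), c j} = {y. E x y}"
      using deg[of x] fin by (metis card_seteq)
    then have "y = c (Suc i mod m) \<or> y = c j" using xy(2) by blast
    then show ?thesis using j(1) k(1) by blast
  qed
  define R where "R x y \<longleftrightarrow> E x y \<and> x \<notin> ?Z \<and> y \<notin> ?Z" for x y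
  have RE: "(E ^^ n) x y" if "(R ^^ n) x y" for n x y
    by (rule relpowp_map[of R E "\<lambda>x. x", OF _ that]) (simp add: R_def)
  have "C5_colourable R"
  proof (rule ccontr)
    assume not_colourable_R: "\<not> C5_colourable R"
    \<comment> \<open>If the rest could not be coloured, everything proved so far would apply to it,
      and it would contain an odd cycle of length at least 7 of its own.\<close>
    interpret R: non_C5_colourable R "V - ?Z"
    proof
      show "symp R" using symD by (auto simp: R_def intro: sympI)
      show "\<not> (R ^^ n) x x" if "n \<in> {1, 3, 5}" for n x using RE no_short that by blast
    qed (use in_V finite_V not_colourable_R in \<open>auto simp: R_def\<close>)
    \<comment> \<open>An edge is needed to obtain a vertex \<open>x\<close> of the rest for the new
      cycle to avoid. This makes the count strict: up to 7 vertices remain outside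
      \<open>?Z\<close>, which alone would still leave room for a 7-cycle.\<close>
    have "C5_colourable R" if "\<nexists>x y. R x y"
      using that unfolding C5_colourable_def by simp
    then obtain x y where "R x y" using R.not_colourable by blast
    then have x: "x \<in> V - ?Z" by (rule R.in_V)
    obtain m' :: nat and c' where c': "7 \<le> m'" "inj_on c' {..<m'}"
      "c' ` {..<m'} \<subseteq> V - ?Z - insert x {y. R x y}"
      by (rule R.odd_cycle_avoiding[of x]) blast
    have "m' = card (c' ` {..<m'})" using c'(2) by (simp add: card_image)
    also have "\<dots> \<le> card (V - ?Z - {x})"
      by (rule card_mono) (use finite_V c' in auto)
    also have "\<dots> < card (V - ?Z)" by (rule psubset_card_mono) (use finite_V x in auto)
    also have "\<dots> = card V - m" using c(3,4) by (simp add: card_Diff_subset card_image)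
    finally show False using c(2) c'(1) assms by simp
  qed
  then obtain h where h: "\<And>x y. R x y \<Longrightarrow> C5_adj (h x) (h y)"
    unfolding C5_colourable_def by blast
  \<comment> \<open>The cycle is wound once around the 5-cycle as 0, 1, 2, 3, 4 and then alternates
    3, 4. As \<open>m\<close> is odd, the last index is even and has colour 4, which is adjacent to
    the colour 0 at the start.\<close>
  define p :: "nat \<Rightarrow> nat" where "p i = (if i \<le> 3 then i else if even i then 4 else 3)" for i
  define g where "g x = (if x \<in> ?Z then p (the_inv_into {..<m} c x) else h x)" for x
  have p: "C5_adj (p i) (p (Suc i mod m))" if "i < m" for i
  proof (cases "Suc i = m")
    case True
    then have "even i" "5 \<le> i" using c(1,2) by auto
    then show ?thesis using True by (simp add: p_def C5_adj_iff)
  next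
    case False
    then have "Suc i mod m = Suc i" using that by simp
    moreover have "C5_adj (p i) (p (Suc i))"
    proof (cases "i \<le> 3")
      case True
      then have "i = 0 \<or> i = 1 \<or> i = 2 \<or> i = 3" by auto
      then show ?thesis by (auto simp: p_def C5_adj_iff)
    qed (auto simp: p_def C5_adj_iff)
    ultimately show ?thesis by simp
  qed
  have "C5_adj (g x) (g y)" if "E x y" for x y
  proof (cases "x \<in> ?Z")
    case True
    then have "y \<in> ?Z" using closed that by blast
    then obtain i j where ij: "i < m" "j < m" "x = c i" "y = c j" using True by auto
    then have "j = Suc i mod m \<or> i = Suc j mod m" using c(5) that by simp
    then have "C5_adj (p i) (p j)" using p ij C5_adj_sym by blast
    then show ?thesis using ij c(3) by (simp add: g_def the_inv_into_f_f)
  next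
    case False
    then have "y \<notin> ?Z" using closed that symD by blast
    then show ?thesis using False h that by (simp add: g_def R_def)
  qed
  then show False using not_colourable unfolding C5_colourable_def by blast
qed

end

section \<open>The labelled configurations\<close>

lemma C5_adj_table:
  "C5_adj 0 0 = False" "C5_adj 0 1 = True" "C5_adj 0 2 = False" "C5_adj 0 3 = False" "C5_adj 0 4 = True"
  "C5_adj 1 0 = True" "C5_adj 1 1 = False" "C5_adj 1 2 = True" "C5_adj 1 3 = False" "C5_adj 1 4 = False"
  "C5_adj 2 0 = False" "C5_adj 2 1 = True" "C5_adj 2 2 = False" "C5_adj 2 3 = True" "C5_adj 2 4 = False"
  "C5_adj 3 0 = False" "C5_adj 3 1 = False" "C5_adj 3 2 = True" "C5_adj 3 3 = False" "C5_adj 3 4 = True"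
  "C5_adj 4 0 = True" "C5_adj 4 1 = False" "C5_adj 4 2 = False" "C5_adj 4 3 = True" "C5_adj 4 4 = False"
  by (simp_all add: C5_adj_iff)

text \<open>
  Labels \<open>0..<m\<close> are the odd cycle, \<open>m\<close> is a vertex of maximum degree \<open>d\<close>, the labels up to \<open>m + d\<close>
  are its neighbours, and those up to 13 are the remaining vertices.
\<close>

locale labelled_obstruction =
  fixes E :: "nat \<Rightarrow> nat \<Rightarrow> bool" and m d :: nat
  assumes sym: "E i j \<longleftrightarrow> E j i"
    and no_short_walk: "length p \<in> {1, 3, 5} \<Longrightarrow> \<not> successively E (p @ [hd p])"
    and degree: "distinct js \<Longrightarrow> d < length js \<Longrightarrow> \<not> list_all (E i) js"
    and no_colouring: "length cs = 14 \<Longrightarrow> list_all (\<lambda>c. c < 5) cs \<Longrightarrow>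
      \<not> sorted_wrt (\<lambda>(i, c) (j, c'). E i j \<longrightarrow> C5_adj c c') (zip [0..<14] cs)"
    and cycle: "i < m \<Longrightarrow> j < m \<Longrightarrow> E i j \<longleftrightarrow> j = Suc i mod m \<or> i = Suc j mod m"
    and star: "E m j \<longleftrightarrow> m < j \<and> j \<le> m + d"
    and rotation: "m = 7 \<Longrightarrow> i \<in> {1, 3, 5, 6} \<Longrightarrow> m < j \<Longrightarrow> j \<le> m + d \<Longrightarrow> \<not> E i j"
begin

text \<open>For concrete \<open>m\<close> and \<open>d\<close> the premise is a computation on
  literals, and the conclusion unfolds into rewrite rules for both orientations of each listed pair.
  The following lemmas present the other assumptions in the same style.\<close>

lemma edges:
  assumes "list_all (\<lambda>(i, j). i < m \<and> j = Suc i mod m \<or> i = m \<and> m < j \<and> j \<le> m + d) es"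
  shows "list_all (\<lambda>(i, j). E i j \<and> E j i) es"
proof -
  have "E i j" if "(i, j) \<in> set es" for i j
  proof -
    have "i < m \<and> j = Suc i mod m \<or> i = m \<and> m < j \<and> j \<le> m + d"
      using assms that by (auto simp: list_all_iff)
    then show ?thesis using cycle[of i j] star[of j] by auto
  qed
  then show ?thesis using sym by (fastforce simp: list_all_iff)
qed

text \<open>The sources are, in order: chordlessness of the cycle, the known neighbourhood of
  \<open>m\<close>, the cycle avoiding that neighbourhood, its independence, and the rotation for
  \<open>m = 7\<close>. Pairs settled neither here nor by \<open>edges\<close> are the unknowns of
  the six cases.\<close>

lemma non_edges:
  assumes "list_all (\<lambda>(i, j).
    i < m \<and> j < m \<and> j \<noteq> Suc i mod m \<and> i \<noteq> Suc j mod m \<or>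
    i = m \<and> m + d < j \<or> j = m \<and> i < m \<or>
    m < i \<and> i \<le> m + d \<and> m < j \<and> j \<le> m + d \<or>
    m = 7 \<and> i \<in> {1, 3, 5, 6} \<and> m < j \<and> j \<le> m + d) es"
  shows "list_all (\<lambda>(i, j). \<not> E i j \<and> \<not> E j i) es"
proof -
  \<comment> \<open>Two adjacent neighbours of \<open>m\<close> would form a triangle with
    it.\<close>
  have indep: "\<not> E i j" if "m < i" "i \<le> m + d" "m < j" "j \<le> m + d" for i j
    using no_short_walk[of "[m, i, j]"] star[of i] star[of j] sym[of j m] that by simp
  have "\<not> E i j" if "(i, j) \<in> set es" for i j
  proof -
    have "i < m \<and> j < m \<and> j \<noteq> Suc i mod m \<and> i \<noteq> Suc j mod m \<or>
      i = m \<and> m + d < j \<or> j = m \<and> i < m \<or>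
      m < i \<and> i \<le> m + d \<and> m < j \<and> j \<le> m + d \<or>
      m = 7 \<and> i \<in> {1, 3, 5, 6} \<and> m < j \<and> j \<le> m + d"
      using bspec[OF assms[unfolded list_all_iff] that] by (simp only: prod.case)
    then show ?thesis
      using cycle[of i j] star[of i] star[of j] sym[of i j] indep[of i j] rotation[of i j] by auto
  qed
  then show ?thesis using sym by (fastforce simp: list_all_iff)
qed

lemma no_short_walks:
  "list_all (\<lambda>p. length p \<in> {1, 3, 5}) ps \<Longrightarrow> list_all (\<lambda>p. \<not> successively E (p @ [hd p])) ps"
  by (simp add: list_all_iff no_short_walk)

text \<open>An entry consists of a centre followed by more than \<open>d\<close> supposed neighbours
  of it.\<close>

lemma degrees:
  "list_all (\<lambda>p. distinct (tl p) \<and> d < length (tl p)) ps \<Longrightarrow>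
    list_all (\<lambda>p. \<not> list_all (E (hd p)) (tl p)) ps"
  using degree by (simp add: list_all_iff)

text \<open>An entry holds at position \<open>i\<close> the colour of label \<open>i\<close>.
  \<open>sorted_wrt\<close> visits each pair of labels once, which is enough for a symmetric
  relation, and the explicit list of labels allows \<open>zip\<close> to be unfolded by plain
  rewriting.\<close>

lemma no_colourings:
  assumes "list_all (\<lambda>cs. length cs = 14 \<and> list_all (\<lambda>c. c < 5) cs) css"
  shows "list_all (\<lambda>cs. \<not> sorted_wrt (\<lambda>(i, c) (j, c'). E i j \<longrightarrow> C5_adj c c')
    (zip [0, 1, 2, 3, 4, 5, 6, 7, 8, 9, 10, 11, 12, 13] cs)) css"
proof -
  have "[0..<14] = [0, 1, 2, 3, 4, 5, 6, 7, 8, 9, 10, 11, 12, 13]"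
    by code_simp
  then show ?thesis using assms no_colouring by (simp add: list_all_iff)
qed

text \<open>The attribute \<open>simplified\<close> with arguments uses exactly the given rules.
  This set evaluates the list predicates on literals and decides adjacency of constant colours,
  leaving clauses in the atoms \<open>E i j\<close>.\<close>

lemmas eval_simps = list.pred_inject list.sel list.set append_Cons append_Nil zip_Cons_Cons
  zip.simps(1) sorted_wrt.simps successively.simps prod.case ball_simps
  C5_adj_table simp_thms de_Morgan_conj
text \<open>
  The closed walks, stars and colourings listed below come from a counterexample-guided SAT search:
  each colouring was found for a graph satisfying the constraints collected so far, and yields the
  clause that one of its improperly coloured pairs is an edge. The lists were then thinned out to a
  nearly minimal unsatisfiable set.
\<close>

lemma no_cycle_7_degree_6:
  assumes "m = 7" "d = 6"
  shows False
proof -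
  have edges: "list_all (\<lambda>(i, j). E i j \<and> E j i) [
      (0,1), (6,0), (1,2), (2,3), (3,4), (4,5), (5,6), (7,8), (7,9), (7,10), (7,11), (7,12),
      (7,13)]"
    by (rule edges) (simp add: assms)
  have non_edges: "list_all (\<lambda>(i, j). \<not> E i j \<and> \<not> E j i) [
      (0,2), (0,3), (0,4), (0,5), (0,7), (1,3), (1,4), (1,5), (1,6), (1,7), (2,4), (2,5), (2,6),
      (2,7), (3,5), (3,6), (3,7), (4,6), (4,7), (5,7), (6,7), (8,9), (8,10), (8,11), (8,12),
      (8,13), (9,10), (9,11), (9,12), (9,13), (10,11), (10,12), (10,13), (11,12), (11,13),
      (12,13), (1,8), (1,9), (1,10), (1,11), (1,12), (1,13), (3,8), (3,9), (3,10), (3,11), (3,12),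
      (3,13), (5,8), (5,9), (5,10), (5,11), (5,12), (5,13), (6,8), (6,9), (6,10), (6,11), (6,12),
      (6,13)]"
    by (rule non_edges) (simp add: assms)
  \<comment> \<open>This colouring is outright proper: the neighbours of \<open>v\<close> get 1, and
    they can be adjacent only to \<open>v\<close> with colour 2 and to the positions 0, 2 and 4 with
    colours 0, 0 and 2.\<close>
  have colourings: "list_all (\<lambda>cs. \<not> sorted_wrt (\<lambda>(i, c) (j, c'). E i j \<longrightarrow> C5_adj c c')
    (zip [0, 1, 2, 3, 4, 5, 6, 7, 8, 9, 10, 11, 12, 13] cs)) [
      [0,1,0,1,2,3,4,2,1,1,1,1,1,1]]"
    by (rule no_colourings) simp
  \<comment> \<open>\<open>sym\<close> is a permutative rule, so ordered rewriting turns the two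
    orientations of an undecided pair into a single propositional atom.\<close>
  note simps = edges[unfolded list.pred_inject prod.case]
    non_edges[unfolded list.pred_inject prod.case] eval_simps sym
  show False
    using colourings[simplified simps]
    by sat
qed

text \<open>No vertex is left over, so the unknowns are the 36 pairs between the cycle and the
  neighbours of \<open>v\<close>. The rotation argument is specific to length 7; here closed walks
  of length 3 and 5 restrict these pairs.\<close>

lemma no_cycle_9_degree_4:
  assumes "m = 9" "d = 4"
  shows False
proof -
  have edges: "list_all (\<lambda>(i, j). E i j \<and> E j i) [
      (0,1), (8,0), (1,2), (2,3), (3,4), (4,5), (5,6), (6,7), (7,8), (9,10), (9,11), (9,12),
      (9,13)]"
    by (rule edges) (simp add: assms)
  have non_edges: "list_all (\<lambda>(i, j). \<not> E i j \<and> \<not> E j i) [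
      (0,2), (0,3), (0,4), (0,5), (0,6), (0,7), (0,9), (1,3), (1,4), (1,5), (1,6), (1,7), (1,8),
      (1,9), (2,4), (2,5), (2,6), (2,7), (2,8), (2,9), (3,5), (3,6), (3,7), (3,8), (3,9), (4,6),
      (4,7), (4,8), (4,9), (5,7), (5,8), (5,9), (6,8), (6,9), (7,9), (8,9), (10,11), (10,12),
      (10,13), (11,12), (11,13), (12,13)]"
    by (rule non_edges) (simp add: assms)
  have walks: "list_all (\<lambda>p. \<not> successively E (p @ [hd p])) [
      [0,1,10], [0,1,11], [0,1,12], [0,1,13], [0,8,10], [0,8,11], [0,8,12], [0,8,13], [1,2,10],
      [1,2,11], [1,2,12], [1,2,13], [2,3,10], [2,3,11], [2,3,12], [2,3,13], [3,4,10], [3,4,11],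
      [3,4,12], [3,4,13], [4,5,10], [4,5,11], [4,5,12], [4,5,13], [5,6,10], [5,6,11], [5,6,12],
      [5,6,13], [6,7,10], [6,7,11], [6,7,12], [6,7,13], [7,8,10], [7,8,11], [7,8,12], [7,8,13],
      [0,1,2,3,10], [0,1,2,3,11], [0,1,2,3,12], [0,1,2,3,13], [0,1,2,10,8], [0,1,2,11,8],
      [0,1,2,12,8], [0,1,2,13,8], [0,1,10,7,8], [0,1,10,9,11], [0,1,10,9,12], [0,1,10,9,13],
      [0,1,11,7,8], [0,1,11,9,12], [0,1,11,9,13], [0,1,12,7,8], [0,1,12,9,10], [0,1,12,9,11],
      [0,1,12,9,13], [0,1,13,7,8], [0,1,13,9,10], [0,1,13,9,11], [0,1,13,9,12], [0,8,7,6,11],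
      [0,8,7,6,12], [0,8,7,6,13], [0,8,10,9,11], [0,8,10,9,12], [0,8,10,9,13], [0,8,11,9,10],
      [0,8,11,9,12], [0,8,11,9,13], [0,8,12,9,10], [0,8,12,9,11], [0,8,12,9,13], [0,8,13,9,10],
      [0,8,13,9,11], [0,8,13,9,12], [1,2,3,4,10], [1,2,3,4,11], [1,2,3,4,12], [1,2,3,4,13],
      [1,2,10,9,11], [1,2,10,9,12], [1,2,10,9,13], [1,2,11,9,10], [1,2,11,9,12], [1,2,11,9,13],
      [1,2,12,9,10], [1,2,12,9,11], [1,2,12,9,13], [1,2,13,9,11], [1,2,13,9,12], [2,3,4,5,10],
      [2,3,4,5,11], [2,3,4,5,12], [2,3,4,5,13], [2,3,10,9,11], [2,3,10,9,12], [2,3,10,9,13],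
      [2,3,11,9,10], [2,3,11,9,12], [2,3,11,9,13], [2,3,12,9,10], [2,3,12,9,11], [2,3,12,9,13],
      [2,3,13,9,12], [3,4,5,6,10], [3,4,5,6,11], [3,4,5,6,12], [3,4,5,6,13], [3,4,10,9,11],
      [3,4,10,9,12], [3,4,10,9,13], [3,4,11,9,10], [3,4,11,9,12], [3,4,11,9,13], [3,4,12,9,10],
      [3,4,12,9,11], [3,4,12,9,13], [3,4,13,9,10], [3,4,13,9,11], [3,4,13,9,12], [4,5,6,7,10],
      [4,5,6,7,11], [4,5,6,7,12], [4,5,6,7,13], [4,5,10,9,11], [4,5,10,9,12], [4,5,10,9,13],
      [4,5,11,9,10], [4,5,11,9,12], [4,5,11,9,13], [4,5,12,9,10], [4,5,12,9,11], [4,5,12,9,13],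
      [4,5,13,9,10], [4,5,13,9,11], [4,5,13,9,12], [5,6,7,8,10], [5,6,7,8,11], [5,6,7,8,12],
      [5,6,10,9,11], [5,6,10,9,12], [5,6,10,9,13], [5,6,11,9,10], [5,6,11,9,12], [5,6,11,9,13],
      [5,6,12,9,10], [5,6,12,9,11], [5,6,12,9,13], [5,6,13,9,10], [5,6,13,9,11], [5,6,13,9,12],
      [6,7,10,9,11], [6,7,10,9,12], [6,7,10,9,13], [6,7,11,9,10], [6,7,11,9,12], [6,7,11,9,13],
      [6,7,12,9,10], [6,7,12,9,11], [6,7,12,9,13], [6,7,13,9,10], [6,7,13,9,11], [6,7,13,9,12],
      [7,8,10,9,11], [7,8,10,9,12], [7,8,10,9,13], [7,8,11,9,10], [7,8,11,9,12], [7,8,11,9,13],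
      [7,8,12,9,10], [7,8,12,9,11], [7,8,12,9,13], [7,8,13,9,10], [7,8,13,9,11], [7,8,13,9,12]]"
    by (rule no_short_walks) simp
  have colourings: "list_all (\<lambda>cs. \<not> sorted_wrt (\<lambda>(i, c) (j, c'). E i j \<longrightarrow> C5_adj c c')
    (zip [0, 1, 2, 3, 4, 5, 6, 7, 8, 9, 10, 11, 12, 13] cs)) [
      [0,1,0,1,0,1,2,3,4,3,2,4,4,2], [0,1,0,1,0,1,2,3,4,3,2,4,4,4], [0,1,0,1,0,1,2,3,4,3,4,2,4,4],
      [0,1,0,1,0,4,3,2,1,3,2,2,4,4], [0,1,0,1,0,4,3,2,1,3,2,4,2,2], [0,1,0,1,2,3,2,3,4,3,2,4,2,4],
      [0,1,0,4,3,2,1,0,1,3,4,2,4,2], [0,1,0,4,3,4,3,2,1,1,0,0,0,0], [0,1,2,1,2,1,2,3,4,3,2,2,2,2],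
      [0,1,2,1,2,1,2,3,4,4,0,3,0,3], [0,1,2,1,2,1,2,3,4,4,3,0,0,3], [0,1,2,1,2,3,4,3,4,4,0,0,0,0],
      [0,1,2,3,2,3,2,3,4,0,1,4,4,4], [0,1,2,3,4,0,1,0,1,0,1,1,4,4], [0,1,2,3,4,0,1,0,1,3,2,2,4,2],
      [0,1,2,3,4,0,1,0,4,1,0,0,0,0], [0,1,2,3,4,0,4,3,4,0,4,4,4,4], [0,4,0,1,2,3,4,3,4,3,4,4,4,4],
      [0,4,0,4,0,1,2,3,4,0,1,1,1,1], [0,4,0,4,0,1,2,3,4,2,1,1,1,3], [0,4,0,4,0,1,2,3,4,2,1,1,3,1],
      [0,4,0,4,0,1,2,3,4,2,1,3,1,1], [0,4,0,4,0,1,2,3,4,2,1,3,3,3], [0,4,0,4,0,1,2,3,4,2,3,3,3,1],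
      [0,4,0,4,0,4,3,2,1,2,1,1,3,3], [0,4,0,4,0,4,3,2,1,2,1,3,3,1], [0,4,0,4,0,4,3,2,1,2,3,1,3,1],
      [0,4,0,4,0,4,3,2,1,2,3,3,1,1], [0,4,0,4,3,2,1,0,4,2,1,1,3,3], [0,4,0,4,3,2,1,0,4,2,1,3,1,3],
      [0,4,0,4,3,2,1,0,4,2,3,1,1,3], [0,4,0,4,3,2,1,0,4,2,3,1,3,1], [0,4,0,4,3,2,1,0,4,2,3,3,1,1],
      [0,4,3,2,1,0,1,2,1,1,0,2,2,2], [0,4,3,2,1,0,4,0,4,2,3,1,1,3], [0,4,3,2,1,2,1,2,1,3,2,2,2,2],
      [0,4,3,2,1,2,1,2,1,4,0,3,0,3], [0,4,3,2,3,2,3,2,1,0,1,1,4,1], [0,4,3,2,3,2,3,2,1,2,1,3,3,1],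
      [0,4,3,4,3,2,1,0,4,3,4,4,4,4], [0,4,3,4,3,4,3,2,1,1,2,2,2,0]]"
    by (rule no_colourings) simp
  note simps = edges[unfolded list.pred_inject prod.case]
    non_edges[unfolded list.pred_inject prod.case] eval_simps sym
  show False
    using walks[simplified simps]
      colourings[simplified simps]
    by sat
qed

text \<open>27 pairs are unknown: 15 between the positions 0, 2, 4 and the neighbours of
  \<open>v\<close>, and 12 at the one remaining vertex 13.\<close>

lemma no_cycle_7_degree_5:
  assumes "m = 7" "d = 5"
  shows False
proof -
  have edges: "list_all (\<lambda>(i, j). E i j \<and> E j i) [
      (0,1), (6,0), (1,2), (2,3), (3,4), (4,5), (5,6), (7,8), (7,9), (7,10), (7,11), (7,12)]"
    by (rule edges) (simp add: assms)
  have non_edges: "list_all (\<lambda>(i, j). \<not> E i j \<and> \<not> E j i) [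
      (0,2), (0,3), (0,4), (0,5), (0,7), (1,3), (1,4), (1,5), (1,6), (1,7), (2,4), (2,5), (2,6),
      (2,7), (3,5), (3,6), (3,7), (4,6), (4,7), (5,7), (6,7), (7,13), (8,9), (8,10), (8,11),
      (8,12), (9,10), (9,11), (9,12), (10,11), (10,12), (11,12), (1,8), (1,9), (1,10), (1,11),
      (1,12), (3,8), (3,9), (3,10), (3,11), (3,12), (5,8), (5,9), (5,10), (5,11), (5,12), (6,8),
      (6,9), (6,10), (6,11), (6,12)]"
    by (rule non_edges) (simp add: assms)
  have walks: "list_all (\<lambda>p. \<not> successively E (p @ [hd p])) [
      [0,1,13], [0,6,13], [0,8,13], [0,9,13], [0,10,13], [0,11,13], [0,12,13], [1,2,13], [2,3,13],
      [2,8,13], [2,9,13], [2,10,13], [2,11,13], [2,12,13], [3,4,13], [4,5,13], [4,8,13], [4,9,13],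
      [4,10,13], [4,11,13], [4,12,13], [5,6,13], [0,1,2,3,13], [0,1,2,13,6], [0,1,2,13,8],
      [0,1,2,13,9], [0,1,2,13,10], [0,1,2,13,11], [0,1,2,13,12], [0,6,5,4,8], [0,6,5,4,9],
      [0,6,5,4,10], [0,6,5,4,11], [0,6,5,4,12], [0,6,5,4,13], [0,8,7,12,13], [0,9,7,12,13],
      [0,10,7,11,13], [0,11,7,8,13], [0,11,7,9,13], [0,12,7,8,13], [0,12,7,10,13], [0,12,7,11,13],
      [1,2,3,4,13], [2,3,4,5,13], [2,3,4,8,13], [2,3,4,9,13], [2,3,4,10,13], [2,3,4,11,13],
      [2,3,4,12,13], [2,8,7,12,13], [2,9,7,8,13], [2,9,7,11,13], [2,9,7,12,13], [2,10,7,8,13],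
      [2,10,7,9,13], [2,10,7,11,13], [2,11,7,8,13], [2,11,7,9,13], [2,11,7,10,13], [2,12,7,8,13],
      [2,12,7,9,13], [4,8,7,10,13], [4,9,7,8,13], [4,9,7,11,13], [4,10,7,9,13], [4,11,7,8,13],
      [4,11,7,10,13], [4,12,7,11,13]]"
    by (rule no_short_walks) simp
  have degrees: "list_all (\<lambda>p. \<not> list_all (E (hd p)) (tl p)) [
      [0,1,6,8,9,10,13], [0,1,6,8,9,11,13], [0,1,6,8,9,12,13], [0,1,6,8,10,11,13],
      [0,1,6,8,10,12,13], [0,1,6,8,11,12,13], [0,1,6,9,10,11,13], [0,1,6,9,10,12,13],
      [0,1,6,9,11,12,13], [0,1,6,10,11,12,13], [2,1,3,8,9,10,13], [2,1,3,8,9,11,13],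
      [2,1,3,8,9,12,13], [2,1,3,8,10,11,13], [2,1,3,8,10,12,13], [2,1,3,8,11,12,13],
      [2,1,3,9,10,11,13], [2,1,3,9,10,12,13], [2,1,3,9,11,12,13], [2,1,3,10,11,12,13],
      [4,3,5,8,9,10,13], [4,3,5,8,9,11,13], [4,3,5,8,9,12,13], [4,3,5,8,10,11,13],
      [4,3,5,8,10,12,13], [4,3,5,8,11,12,13], [4,3,5,9,10,11,13], [4,3,5,9,10,12,13],
      [4,3,5,9,11,12,13], [4,3,5,10,11,12,13]]"
    by (rule degrees) (simp add: assms)
  have colourings: "list_all (\<lambda>cs. \<not> sorted_wrt (\<lambda>(i, c) (j, c'). E i j \<longrightarrow> C5_adj c c')
    (zip [0, 1, 2, 3, 4, 5, 6, 7, 8, 9, 10, 11, 12, 13] cs)) [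
      [0,1,0,4,3,2,1,0,1,1,1,4,4,2], [0,1,0,4,3,2,1,0,1,1,4,4,1,2], [0,1,0,4,3,2,1,0,1,4,1,4,1,2],
      [0,1,0,4,3,2,1,0,4,1,1,1,4,2], [0,1,0,4,3,2,1,0,4,1,4,1,1,2], [0,1,0,4,3,2,1,0,4,4,1,1,1,2],
      [0,1,0,4,3,2,1,3,2,2,4,2,2,1], [0,1,0,4,3,2,1,3,2,4,4,4,4,1], [0,1,0,4,3,2,1,3,4,2,4,4,4,1],
      [0,1,0,4,3,2,1,3,4,4,2,4,4,1], [0,1,0,4,3,2,1,3,4,4,4,2,4,1], [0,1,0,4,3,2,1,3,4,4,4,4,4,0],
      [0,1,2,3,2,3,4,0,1,1,1,1,4,3], [0,1,2,3,2,3,4,0,1,4,1,1,1,3], [0,1,2,3,2,3,4,0,1,4,1,4,4,3],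
      [0,1,2,3,2,3,4,0,1,4,4,1,4,3], [0,1,2,3,2,3,4,0,4,1,4,4,4,3], [0,1,2,3,2,3,4,0,4,4,4,1,4,3],
      [0,1,2,3,2,3,4,0,4,4,4,4,1,3], [0,1,2,3,2,3,4,0,4,4,4,4,4,3], [0,1,2,3,2,3,4,2,1,3,3,3,1,4],
      [0,1,2,3,2,3,4,2,3,3,1,1,3,4], [0,1,2,3,2,3,4,2,3,3,1,3,1,4], [0,1,2,3,4,0,4,2,3,1,1,3,1,0],
      [0,1,2,3,4,0,4,2,3,3,3,1,1,4], [0,4,0,1,2,3,4,0,4,1,1,4,4,3], [0,4,0,1,2,3,4,0,4,1,4,4,1,3],
      [0,4,0,1,2,3,4,0,4,4,1,4,1,3], [0,4,0,1,2,3,4,2,1,1,1,1,3,4], [0,4,0,1,2,3,4,2,1,1,3,3,1,4],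
      [0,4,0,1,2,3,4,2,1,3,3,3,3,4], [0,4,0,1,2,3,4,2,3,1,3,3,3,4], [0,4,0,1,2,3,4,2,3,3,3,1,3,4],
      [0,4,0,1,2,3,4,2,3,3,3,3,1,4], [0,4,0,4,3,2,1,0,1,1,1,1,1,2], [0,4,0,4,3,2,1,2,3,3,3,3,3,4],
      [0,4,3,2,1,0,1,3,4,2,4,2,2,1], [0,4,3,2,1,0,1,3,4,4,2,2,2,1], [0,4,3,2,3,2,1,0,1,1,4,1,1,2],
      [0,4,3,2,3,2,1,0,1,4,4,4,4,2], [0,4,3,2,3,2,1,0,4,1,1,1,4,2], [0,4,3,2,3,2,1,0,4,4,1,4,4,2],
      [0,4,3,2,3,2,1,0,4,4,4,1,4,2], [0,4,3,2,3,2,1,0,4,4,4,4,4,3], [0,4,3,2,3,2,1,3,2,2,2,2,2,1],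
      [0,4,3,2,3,2,1,3,2,4,2,2,4,1], [0,4,3,2,3,2,1,3,2,4,2,4,2,1], [0,4,3,2,3,2,1,3,4,2,2,4,2,1],
      [0,4,3,4,3,2,1,3,2,4,4,2,2,1]]"
    by (rule no_colourings) simp
  note simps = edges[unfolded list.pred_inject prod.case]
    non_edges[unfolded list.pred_inject prod.case] eval_simps sym
  show False
    using walks[simplified simps]
      degrees[simplified simps]
      colourings[simplified simps]
    by sat
qed

text \<open>39 pairs are unknown: 27 between the cycle and the neighbours of \<open>v\<close>, and
  12 at the remaining vertex 13. The degree clauses say that each cycle vertex has at most one
  neighbour off the cycle.\<close>

lemma no_cycle_9_degree_3:
  assumes "m = 9" "d = 3"
  shows False
proof -
  have edges: "list_all (\<lambda>(i, j). E i j \<and> E j i) [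
      (0,1), (8,0), (1,2), (2,3), (3,4), (4,5), (5,6), (6,7), (7,8), (9,10), (9,11), (9,12)]"
    by (rule edges) (simp add: assms)
  have non_edges: "list_all (\<lambda>(i, j). \<not> E i j \<and> \<not> E j i) [
      (0,2), (0,3), (0,4), (0,5), (0,6), (0,7), (0,9), (1,3), (1,4), (1,5), (1,6), (1,7), (1,8),
      (1,9), (2,4), (2,5), (2,6), (2,7), (2,8), (2,9), (3,5), (3,6), (3,7), (3,8), (3,9), (4,6),
      (4,7), (4,8), (4,9), (5,7), (5,8), (5,9), (6,8), (6,9), (7,9), (8,9), (9,13), (10,11),
      (10,12), (11,12)]"
    by (rule non_edges) (simp add: assms)
  have walks: "list_all (\<lambda>p. \<not> successively E (p @ [hd p])) [
      [0,1,10], [0,1,11], [0,1,12], [0,1,13], [0,8,10], [0,8,11], [0,8,12], [0,8,13], [1,2,10],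
      [1,2,11], [1,2,12], [1,2,13], [2,3,10], [2,3,11], [2,3,12], [2,3,13], [3,4,10], [3,4,11],
      [3,4,12], [3,4,13], [4,5,10], [4,5,11], [4,5,12], [4,5,13], [5,6,10], [5,6,11], [5,6,12],
      [5,6,13], [6,7,10], [6,7,11], [6,7,12], [6,7,13], [7,8,10], [7,8,11], [7,8,12], [7,8,13],
      [0,1,2,3,10], [0,1,2,3,11], [0,1,2,3,12], [0,1,2,3,13], [0,1,2,10,8], [0,1,2,10,13],
      [0,1,2,11,8], [0,1,2,11,13], [0,1,2,12,8], [0,1,2,12,13], [0,1,2,13,8], [0,1,2,13,10],
      [0,1,2,13,11], [0,1,2,13,12], [0,1,10,7,8], [0,1,10,9,11], [0,1,10,9,12], [0,1,10,13,8],
      [0,1,11,7,8], [0,1,11,9,10], [0,1,11,9,12], [0,1,11,13,8], [0,1,12,7,8], [0,1,12,9,10],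
      [0,1,12,9,11], [0,1,12,13,8], [0,1,13,7,8], [0,1,13,10,8], [0,1,13,11,8], [0,1,13,12,8],
      [0,8,7,6,10], [0,8,7,6,11], [0,8,7,6,12], [0,8,7,6,13], [0,8,7,10,13], [0,8,7,11,13],
      [0,8,7,12,13], [0,8,7,13,10], [0,8,7,13,11], [0,8,7,13,12], [0,8,10,9,11], [0,8,10,9,12],
      [0,8,11,9,10], [0,8,11,9,12], [0,8,12,9,10], [0,8,12,9,11], [1,2,3,4,10], [1,2,3,4,11],
      [1,2,3,4,12], [1,2,3,4,13], [1,2,3,10,13], [1,2,3,11,13], [1,2,3,12,13], [1,2,3,13,10],
      [1,2,3,13,11], [1,2,3,13,12], [1,2,10,9,11], [1,2,10,9,12], [1,2,11,9,10], [1,2,11,9,12],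
      [1,2,12,9,10], [1,2,12,9,11], [2,3,4,5,10], [2,3,4,5,11], [2,3,4,5,12], [2,3,4,5,13],
      [2,3,4,10,13], [2,3,4,11,13], [2,3,4,12,13], [2,3,4,13,10], [2,3,4,13,11], [2,3,4,13,12],
      [2,3,10,9,11], [2,3,10,9,12], [2,3,11,9,10], [2,3,11,9,12], [2,3,12,9,10], [2,3,12,9,11],
      [3,4,5,6,10], [3,4,5,6,11], [3,4,5,6,12], [3,4,5,6,13], [3,4,5,10,13], [3,4,5,11,13],
      [3,4,5,12,13], [3,4,5,13,10], [3,4,5,13,11], [3,4,5,13,12], [3,4,10,9,11], [3,4,10,9,12],
      [3,4,11,9,10], [3,4,11,9,12], [3,4,12,9,10], [3,4,12,9,11], [4,5,6,7,10], [4,5,6,7,11],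
      [4,5,6,7,12], [4,5,6,7,13], [4,5,6,10,13], [4,5,6,11,13], [4,5,6,12,13], [4,5,6,13,10],
      [4,5,6,13,11], [4,5,6,13,12], [4,5,10,9,11], [4,5,10,9,12], [4,5,11,9,10], [4,5,11,9,12],
      [4,5,12,9,10], [4,5,12,9,11], [5,6,7,8,10], [5,6,7,8,11], [5,6,7,8,12], [5,6,7,8,13],
      [5,6,7,10,13], [5,6,7,11,13], [5,6,7,12,13], [5,6,7,13,10], [5,6,7,13,11], [5,6,7,13,12],
      [5,6,10,9,11], [5,6,10,9,12], [5,6,11,9,10], [5,6,11,9,12], [5,6,12,9,10], [5,6,12,9,11],
      [6,7,8,10,13], [6,7,8,11,13], [6,7,8,12,13], [6,7,8,13,10], [6,7,8,13,11], [6,7,8,13,12],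
      [6,7,10,9,11], [6,7,10,9,12], [6,7,11,9,10], [6,7,11,9,12], [6,7,12,9,10], [6,7,12,9,11],
      [7,8,10,9,11], [7,8,10,9,12], [7,8,11,9,10], [7,8,11,9,12], [7,8,12,9,10], [7,8,12,9,11]]"
    by (rule no_short_walks) simp
  have degrees: "list_all (\<lambda>p. \<not> list_all (E (hd p)) (tl p)) [
      [0,1,8,10,11], [0,1,8,10,12], [0,1,8,10,13], [0,1,8,11,12], [0,1,8,11,13], [0,1,8,12,13],
      [1,0,2,10,11], [1,0,2,10,12], [1,0,2,10,13], [1,0,2,11,12], [1,0,2,11,13], [1,0,2,12,13],
      [2,1,3,10,11], [2,1,3,10,12], [2,1,3,10,13], [2,1,3,11,12], [2,1,3,11,13], [2,1,3,12,13],
      [3,2,4,10,11], [3,2,4,10,12], [3,2,4,10,13], [3,2,4,11,12], [3,2,4,11,13], [3,2,4,12,13],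
      [4,3,5,10,11], [4,3,5,10,12], [4,3,5,10,13], [4,3,5,11,12], [4,3,5,11,13], [4,3,5,12,13],
      [5,4,6,10,11], [5,4,6,10,12], [5,4,6,10,13], [5,4,6,11,12], [5,4,6,11,13], [5,4,6,12,13],
      [6,5,7,10,11], [6,5,7,10,12], [6,5,7,10,13], [6,5,7,11,12], [6,5,7,11,13], [6,5,7,12,13],
      [7,6,8,10,11], [7,6,8,10,12], [7,6,8,10,13], [7,6,8,11,12], [7,6,8,11,13], [7,6,8,12,13],
      [8,0,7,10,11], [8,0,7,10,12], [8,0,7,10,13], [8,0,7,11,12], [8,0,7,11,13], [8,0,7,12,13]]"
    by (rule degrees) (simp add: assms)
  have colourings: "list_all (\<lambda>cs. \<not> sorted_wrt (\<lambda>(i, c) (j, c'). E i j \<longrightarrow> C5_adj c c')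
    (zip [0, 1, 2, 3, 4, 5, 6, 7, 8, 9, 10, 11, 12, 13] cs)) [
      [0,1,0,1,0,1,2,3,4,3,2,2,4,1], [0,1,0,1,0,1,2,3,4,3,2,4,2,1], [0,1,0,1,0,4,3,2,1,3,2,4,4,0],
      [0,1,0,1,0,4,3,2,1,3,4,2,4,0], [0,1,0,1,2,3,2,3,4,0,1,4,1,2], [0,1,0,1,2,3,4,0,1,3,2,2,4,1],
      [0,1,0,1,2,3,4,0,1,3,2,4,4,0], [0,1,0,1,2,3,4,0,1,3,4,2,4,3], [0,1,0,1,2,3,4,0,1,3,4,4,2,0],
      [0,1,0,4,0,1,2,3,4,1,0,0,0,4], [0,1,0,4,0,1,2,3,4,2,1,1,3,2], [0,1,0,4,3,2,1,0,1,0,1,1,1,2],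
      [0,1,0,4,3,2,1,0,1,3,4,2,2,1], [0,1,0,4,3,2,1,2,1,1,2,2,2,1], [0,1,0,4,3,2,3,2,1,0,1,4,1,2],
      [0,1,0,4,3,4,3,2,1,4,0,0,0,4], [0,1,2,1,0,1,2,3,4,3,2,2,4,3], [0,1,2,1,0,4,3,2,1,3,2,2,4,3],
      [0,1,2,1,2,1,2,3,4,1,2,2,2,3], [0,1,2,1,2,1,2,3,4,4,0,3,0,1], [0,1,2,1,2,1,2,3,4,4,3,0,0,1],
      [0,1,2,1,2,3,4,0,1,3,2,4,2,1], [0,1,2,1,2,3,4,0,4,0,1,1,1,0], [0,1,2,1,2,3,4,0,4,1,0,0,0,1],
      [0,1,2,1,2,3,4,0,4,2,1,3,1,0], [0,1,2,1,2,3,4,0,4,4,3,0,0,1], [0,1,2,1,2,3,4,3,4,4,3,3,0,2],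
      [0,1,2,3,2,1,2,3,4,0,1,1,1,2], [0,1,2,3,2,1,2,3,4,4,0,3,3,4], [0,1,2,3,2,1,2,3,4,4,3,3,3,2],
      [0,1,2,3,2,3,2,3,4,0,1,4,4,3], [0,1,2,3,2,3,2,3,4,0,4,1,1,2], [0,1,2,3,2,3,2,3,4,0,4,1,4,3],
      [0,1,2,3,2,3,2,3,4,0,4,4,1,3], [0,1,2,3,2,3,4,0,1,0,4,1,1,2], [0,1,2,3,2,3,4,0,4,2,1,1,3,0],
      [0,1,2,3,2,3,4,0,4,2,3,1,3,4], [0,1,2,3,4,0,1,0,1,0,1,1,1,2], [0,1,2,3,4,0,1,0,1,3,2,4,2,1],
      [0,1,2,3,4,0,1,0,1,3,4,2,4,0], [0,1,2,3,4,0,4,0,4,2,1,1,3,0], [0,1,2,3,4,0,4,0,4,2,3,1,1,0],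
      [0,1,2,3,4,0,4,3,4,0,4,4,4,0], [0,1,2,3,4,3,4,0,1,1,0,0,0,4], [0,1,2,3,4,3,4,3,4,1,0,0,2,4],
      [0,4,0,1,0,1,2,3,4,2,3,3,1,4], [0,4,0,1,2,1,2,3,4,2,1,1,3,0], [0,4,0,1,2,1,2,3,4,4,0,0,3,1],
      [0,4,0,1,2,3,2,3,4,2,3,1,3,4], [0,4,0,1,2,3,4,0,4,2,3,1,1,0], [0,4,0,1,2,3,4,0,4,2,3,3,1,4],
      [0,4,0,1,2,3,4,3,4,1,0,0,0,4], [0,4,0,4,0,1,2,3,4,2,1,1,1,0], [0,4,0,4,0,4,3,2,1,2,1,1,3,0],
      [0,4,0,4,0,4,3,2,1,2,1,3,1,0], [0,4,0,4,0,4,3,2,1,2,1,3,3,4], [0,4,0,4,0,4,3,2,1,2,3,1,3,2],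
      [0,4,0,4,3,2,1,0,4,2,1,3,1,0], [0,4,0,4,3,2,1,0,4,2,1,3,3,4], [0,4,0,4,3,2,1,2,1,4,3,3,0,2],
      [0,4,3,2,1,0,1,0,1,3,2,2,4,1], [0,4,3,2,1,0,1,0,1,3,4,2,2,1], [0,4,3,2,1,0,4,0,4,2,1,1,3,0],
      [0,4,3,2,1,0,4,0,4,2,1,3,3,4], [0,4,3,2,1,0,4,0,4,2,3,1,1,0], [0,4,3,2,1,0,4,0,4,2,3,3,1,4],
      [0,4,3,2,1,2,1,2,1,4,0,3,0,1], [0,4,3,2,1,2,1,2,1,4,0,3,3,2], [0,4,3,2,1,2,1,2,1,4,3,0,0,1],
      [0,4,3,2,1,2,1,2,1,4,3,0,3,2], [0,4,3,2,1,2,3,2,1,0,1,1,4,0], [0,4,3,2,3,2,1,0,1,2,1,1,1,2],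
      [0,4,3,2,3,2,1,0,4,3,4,4,4,3], [0,4,3,2,3,2,3,2,1,0,4,4,1,3], [0,4,3,2,3,4,3,2,1,1,2,2,0,1],
      [0,4,3,2,3,4,3,2,1,2,3,3,3,4], [0,4,3,4,0,4,3,2,1,2,1,3,3,2], [0,4,3,4,3,2,1,0,1,1,0,2,0,4],
      [0,4,3,4,3,2,3,2,1,1,0,2,2,3], [0,4,3,4,3,2,3,2,1,1,2,2,2,1], [0,4,3,4,3,4,3,2,1,1,2,0,2,1],
      [0,4,3,4,3,4,3,2,1,1,2,0,2,3]]"
    by (rule no_colourings) simp
  note simps = edges[unfolded list.pred_inject prod.case]
    non_edges[unfolded list.pred_inject prod.case] eval_simps sym
  show False
    using walks[simplified simps]
      degrees[simplified simps]
      colourings[simplified simps]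
    by sat
qed

text \<open>35 pairs are unknown: 12 between the positions 0, 2, 4 and the neighbours of
  \<open>v\<close>, and 23 that involve the remaining vertices 12 and 13. The degree bound is now
  also needed at these two.\<close>

lemma no_cycle_7_degree_4:
  assumes "m = 7" "d = 4"
  shows False
proof -
  have edges: "list_all (\<lambda>(i, j). E i j \<and> E j i) [
      (0,1), (6,0), (1,2), (2,3), (3,4), (4,5), (5,6), (7,8), (7,9), (7,10), (7,11)]"
    by (rule edges) (simp add: assms)
  have non_edges: "list_all (\<lambda>(i, j). \<not> E i j \<and> \<not> E j i) [
      (0,2), (0,3), (0,4), (0,5), (0,7), (1,3), (1,4), (1,5), (1,6), (1,7), (2,4), (2,5), (2,6),
      (2,7), (3,5), (3,6), (3,7), (4,6), (4,7), (5,7), (6,7), (7,12), (7,13), (8,9), (8,10),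
      (8,11), (9,10), (9,11), (10,11), (1,8), (1,9), (1,10), (1,11), (3,8), (3,9), (3,10), (3,11),
      (5,8), (5,9), (5,10), (5,11), (6,8), (6,9), (6,10), (6,11)]"
    by (rule non_edges) (simp add: assms)
  have walks: "list_all (\<lambda>p. \<not> successively E (p @ [hd p])) [
      [0,1,12], [0,1,13], [0,6,12], [0,6,13], [0,8,12], [0,8,13], [0,9,12], [0,9,13], [0,10,12],
      [0,10,13], [0,11,12], [0,11,13], [0,12,13], [1,2,12], [1,2,13], [1,12,13], [2,3,12],
      [2,3,13], [2,8,12], [2,8,13], [2,9,12], [2,9,13], [2,10,12], [2,10,13], [2,11,12],
      [2,11,13], [2,12,13], [3,4,12], [3,4,13], [3,12,13], [4,5,12], [4,5,13], [4,8,12], [4,8,13],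
      [4,9,12], [4,9,13], [4,10,12], [4,10,13], [4,11,12], [4,11,13], [4,12,13], [5,6,12],
      [5,6,13], [5,12,13], [6,12,13], [8,12,13], [9,12,13], [10,12,13], [11,12,13], [0,1,2,3,12],
      [0,1,2,3,13], [0,1,2,8,12], [0,1,2,8,13], [0,1,2,9,12], [0,1,2,9,13], [0,1,2,10,12],
      [0,1,2,10,13], [0,1,2,11,12], [0,1,2,11,13], [0,1,2,12,6], [0,1,2,12,8], [0,1,2,12,9],
      [0,1,2,12,10], [0,1,2,12,11], [0,1,2,12,13], [0,1,2,13,6], [0,1,2,13,8], [0,1,2,13,9],
      [0,1,2,13,10], [0,1,2,13,11], [0,1,2,13,12], [0,1,12,5,6], [0,1,12,10,13], [0,1,12,13,6],
      [0,1,12,13,8], [0,1,12,13,9], [0,1,12,13,10], [0,1,12,13,11], [0,1,13,5,6], [0,1,13,12,8],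
      [0,1,13,12,9], [0,1,13,12,10], [0,1,13,12,11], [0,6,5,4,8], [0,6,5,4,9], [0,6,5,4,10],
      [0,6,5,4,11], [0,6,5,4,12], [0,6,5,4,13], [0,6,5,12,8], [0,6,5,12,9], [0,6,5,12,10],
      [0,6,5,12,11], [0,6,5,12,13], [0,6,5,13,8], [0,6,5,13,9], [0,6,5,13,10], [0,6,5,13,11],
      [0,6,5,13,12], [0,6,12,8,13], [0,6,12,9,13], [0,6,12,10,13], [0,6,12,11,13], [0,6,13,8,12],
      [0,6,13,9,12], [0,6,13,10,12], [0,6,13,11,12], [0,8,7,9,12], [0,8,7,9,13], [0,8,7,10,12],
      [0,8,7,10,13], [0,8,7,11,12], [0,8,7,11,13], [0,9,7,8,12], [0,9,7,8,13], [0,9,7,10,12],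
      [0,9,7,10,13], [0,9,7,11,12], [0,9,7,11,13], [0,10,7,8,12], [0,10,7,8,13], [0,10,7,9,12],
      [0,10,7,9,13], [0,10,7,11,12], [0,10,7,11,13], [0,11,7,8,12], [0,11,7,8,13], [0,11,7,9,12],
      [0,11,7,9,13], [0,11,7,10,12], [0,11,7,10,13], [1,2,3,4,12], [1,2,3,4,13], [1,2,3,12,13],
      [1,2,3,13,12], [1,2,8,12,13], [1,2,8,13,12], [1,2,9,12,13], [1,2,9,13,12], [1,2,10,12,13],
      [1,2,10,13,12], [1,2,11,12,13], [1,2,11,13,12], [1,2,12,8,13], [1,2,12,9,13],
      [1,2,12,10,13], [1,2,12,11,13], [1,2,13,8,12], [1,2,13,9,12], [1,2,13,11,12], [2,3,4,5,12],
      [2,3,4,5,13], [2,3,4,8,12], [2,3,4,8,13], [2,3,4,9,12], [2,3,4,9,13], [2,3,4,10,12],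
      [2,3,4,10,13], [2,3,4,11,12], [2,3,4,11,13], [2,3,4,12,8], [2,3,4,12,9], [2,3,4,12,10],
      [2,3,4,12,11], [2,3,4,12,13], [2,3,4,13,8], [2,3,4,13,9], [2,3,4,13,10], [2,3,4,13,11],
      [2,3,4,13,12], [2,3,12,8,13], [2,3,12,9,13], [2,3,12,10,13], [2,3,12,11,13], [2,3,13,8,12],
      [2,3,13,9,12], [2,3,13,10,12], [2,3,13,11,12], [2,3,13,12,8], [2,3,13,12,9], [2,3,13,12,10],
      [2,3,13,12,11], [2,8,7,9,12], [2,8,7,9,13], [2,8,7,10,12], [2,8,7,10,13], [2,8,7,11,12],
      [2,8,7,11,13], [2,9,7,8,12], [2,9,7,8,13], [2,9,7,10,12], [2,9,7,10,13], [2,9,7,11,12],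
      [2,9,7,11,13], [2,10,7,8,12], [2,10,7,8,13], [2,10,7,9,12], [2,10,7,9,13], [2,10,7,11,12],
      [2,10,7,11,13], [2,11,7,8,12], [2,11,7,8,13], [2,11,7,9,12], [2,11,7,9,13], [2,11,7,10,12],
      [2,11,7,10,13], [3,4,5,6,12], [3,4,5,6,13], [3,4,5,12,13], [3,4,5,13,12], [3,4,8,12,13],
      [3,4,8,13,12], [3,4,9,12,13], [3,4,9,13,12], [3,4,10,12,13], [3,4,10,13,12], [3,4,11,12,13],
      [3,4,11,13,12], [3,4,12,8,13], [3,4,12,9,13], [3,4,12,10,13], [3,4,12,11,13], [4,5,6,12,8],
      [4,5,6,12,9], [4,5,6,12,10], [4,5,6,12,11], [4,5,6,12,13], [4,5,6,13,8], [4,5,6,13,9],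
      [4,5,6,13,11], [4,5,6,13,12], [4,5,12,8,13], [4,5,12,9,13], [4,5,12,10,13], [4,5,12,11,13],
      [4,5,12,13,8], [4,5,12,13,11], [4,5,13,8,12], [4,5,13,9,12], [4,5,13,10,12], [4,5,13,11,12],
      [4,8,7,9,12], [4,8,7,9,13], [4,8,7,10,12], [4,8,7,10,13], [4,8,7,11,12], [4,8,7,11,13],
      [4,9,7,8,12], [4,9,7,8,13], [4,9,7,10,12], [4,9,7,10,13], [4,9,7,11,12], [4,9,7,11,13],
      [4,10,7,8,12], [4,10,7,8,13], [4,10,7,9,12], [4,10,7,9,13], [4,10,7,11,12], [4,10,7,11,13],
      [4,11,7,8,12], [4,11,7,8,13], [4,11,7,9,12], [4,11,7,9,13], [4,11,7,10,12], [4,11,7,10,13],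
      [7,8,12,13,9], [7,8,12,13,10], [7,8,12,13,11], [7,8,13,12,9], [7,8,13,12,10],
      [7,8,13,12,11], [7,9,12,13,10], [7,9,12,13,11], [7,9,13,12,10], [7,9,13,12,11],
      [7,10,12,13,11], [7,10,13,12,11]]"
    by (rule no_short_walks) simp
  have degrees: "list_all (\<lambda>p. \<not> list_all (E (hd p)) (tl p)) [
      [0,1,6,8,9,10], [0,1,6,8,9,11], [0,1,6,8,9,12], [0,1,6,8,9,13], [0,1,6,8,10,11],
      [0,1,6,8,10,12], [0,1,6,8,10,13], [0,1,6,8,11,12], [0,1,6,8,11,13], [0,1,6,8,12,13],
      [0,1,6,9,10,11], [0,1,6,9,10,12], [0,1,6,9,10,13], [0,1,6,9,11,12], [0,1,6,9,11,13],
      [0,1,6,9,12,13], [0,1,6,10,11,12], [0,1,6,10,11,13], [0,1,6,10,12,13], [0,1,6,11,12,13],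
      [2,1,3,8,9,10], [2,1,3,8,9,11], [2,1,3,8,9,12], [2,1,3,8,9,13], [2,1,3,8,10,11],
      [2,1,3,8,10,12], [2,1,3,8,10,13], [2,1,3,8,11,12], [2,1,3,8,11,13], [2,1,3,8,12,13],
      [2,1,3,9,10,11], [2,1,3,9,10,12], [2,1,3,9,10,13], [2,1,3,9,11,12], [2,1,3,9,11,13],
      [2,1,3,9,12,13], [2,1,3,10,11,12], [2,1,3,10,11,13], [2,1,3,10,12,13], [2,1,3,11,12,13],
      [4,3,5,8,9,10], [4,3,5,8,9,11], [4,3,5,8,9,12], [4,3,5,8,9,13], [4,3,5,8,10,11],
      [4,3,5,8,10,12], [4,3,5,8,10,13], [4,3,5,8,11,12], [4,3,5,8,11,13], [4,3,5,8,12,13],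
      [4,3,5,9,10,11], [4,3,5,9,10,12], [4,3,5,9,10,13], [4,3,5,9,11,12], [4,3,5,9,11,13],
      [4,3,5,9,12,13], [4,3,5,10,11,12], [4,3,5,10,11,13], [4,3,5,10,12,13], [4,3,5,11,12,13],
      [12,0,5,8,9,10], [12,0,5,8,9,11], [12,0,5,8,10,11], [12,4,6,9,10,11], [13,0,2,9,10,11],
      [13,0,5,8,9,11], [13,0,8,9,10,11], [13,2,4,8,10,11], [13,2,8,10,11,12], [13,4,8,10,11,12]]"
    by (rule degrees) (simp add: assms)
  have colourings: "list_all (\<lambda>cs. \<not> sorted_wrt (\<lambda>(i, c) (j, c'). E i j \<longrightarrow> C5_adj c c')
    (zip [0, 1, 2, 3, 4, 5, 6, 7, 8, 9, 10, 11, 12, 13] cs)) [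
      [0,1,0,1,2,3,4,0,1,1,1,1,2,0], [0,1,0,1,2,3,4,3,2,2,2,4,0,1], [0,1,0,1,2,3,4,3,2,2,2,4,1,1],
      [0,1,0,1,2,3,4,3,2,2,2,4,1,3], [0,1,0,1,2,3,4,3,2,2,4,2,3,1], [0,1,0,1,2,3,4,3,2,4,2,4,3,1],
      [0,1,0,1,2,3,4,3,2,4,4,2,1,1], [0,1,0,1,2,3,4,3,4,2,2,2,1,3], [0,1,0,1,2,3,4,3,4,2,2,2,3,1],
      [0,1,0,1,2,3,4,3,4,2,2,4,1,1], [0,1,0,1,2,3,4,3,4,2,4,2,0,1], [0,1,0,1,2,3,4,3,4,4,2,2,1,1],
      [0,1,0,4,3,2,1,0,1,1,1,4,2,1], [0,1,0,4,3,2,1,0,1,4,1,1,0,2], [0,1,0,4,3,2,1,2,1,1,1,1,2,2],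
      [0,1,0,4,3,2,1,3,2,2,2,4,0,1], [0,1,0,4,3,2,1,3,2,2,2,4,1,0], [0,1,0,4,3,2,1,3,2,2,2,4,1,1],
      [0,1,0,4,3,2,1,3,2,2,2,4,1,3], [0,1,0,4,3,2,1,3,2,2,2,4,1,4], [0,1,0,4,3,2,1,3,2,2,2,4,3,1],
      [0,1,0,4,3,2,1,3,2,2,2,4,4,1], [0,1,0,4,3,2,1,3,2,2,4,2,3,1], [0,1,0,4,3,2,1,3,2,2,4,4,0,1],
      [0,1,0,4,3,2,1,3,2,2,4,4,1,1], [0,1,0,4,3,2,1,3,2,4,2,2,0,1], [0,1,0,4,3,2,1,3,2,4,2,2,1,3],
      [0,1,0,4,3,2,1,3,2,4,2,2,1,4], [0,1,0,4,3,2,1,3,2,4,2,2,3,1], [0,1,0,4,3,2,1,3,2,4,2,4,1,1],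
      [0,1,0,4,3,2,1,3,2,4,4,2,0,1], [0,1,0,4,3,2,1,3,2,4,4,2,1,0], [0,1,0,4,3,2,1,3,2,4,4,2,1,1],
      [0,1,0,4,3,2,1,3,2,4,4,4,0,1], [0,1,0,4,3,2,1,3,4,2,2,2,1,0], [0,1,0,4,3,2,1,3,4,2,2,2,1,4],
      [0,1,0,4,3,2,1,3,4,2,2,2,4,1], [0,1,0,4,3,2,1,3,4,2,2,4,0,1], [0,1,0,4,3,2,1,3,4,2,4,2,1,0],
      [0,1,0,4,3,2,1,3,4,2,4,2,1,1], [0,1,0,4,3,2,1,3,4,2,4,4,0,1], [0,1,0,4,3,2,1,3,4,4,2,2,0,1],
      [0,1,0,4,3,2,1,3,4,4,2,2,1,0], [0,1,0,4,3,2,1,3,4,4,2,4,1,0], [0,1,0,4,3,2,1,3,4,4,4,2,0,1],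
      [0,1,0,4,3,2,1,3,4,4,4,4,0,0], [0,1,2,1,2,3,4,0,1,1,1,1,2,3], [0,1,2,1,2,3,4,0,1,1,1,1,3,2],
      [0,1,2,1,2,3,4,4,0,0,0,3,2,1], [0,1,2,1,2,3,4,4,3,0,3,0,4,1], [0,1,2,1,2,3,4,4,3,3,0,0,4,1],
      [0,1,2,1,2,3,4,4,3,3,3,0,4,4], [0,1,2,1,2,3,4,4,3,3,3,3,4,2], [0,1,2,3,2,3,4,0,1,1,1,4,3,2],
      [0,1,2,3,2,3,4,0,1,1,4,1,2,3], [0,1,2,3,2,3,4,0,1,1,4,1,3,2], [0,1,2,3,2,3,4,0,1,1,4,4,3,2],
      [0,1,2,3,2,3,4,0,1,4,1,1,2,3], [0,1,2,3,2,3,4,0,1,4,1,4,0,3], [0,1,2,3,2,3,4,0,1,4,1,4,3,2],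
      [0,1,2,3,2,3,4,0,1,4,4,4,3,1], [0,1,2,3,2,3,4,0,1,4,4,4,3,2], [0,1,2,3,2,3,4,0,4,1,1,1,3,2],
      [0,1,2,3,2,3,4,0,4,1,1,4,2,3], [0,1,2,3,2,3,4,0,4,1,4,1,3,0], [0,1,2,3,2,3,4,0,4,1,4,4,0,3],
      [0,1,2,3,2,3,4,0,4,1,4,4,3,3], [0,1,2,3,2,3,4,0,4,4,1,1,0,3], [0,1,2,3,2,3,4,0,4,4,1,1,3,2],
      [0,1,2,3,2,3,4,0,4,4,1,4,2,3], [0,1,2,3,2,3,4,0,4,4,1,4,3,1], [0,1,2,3,2,3,4,0,4,4,1,4,3,2],
      [0,1,2,3,2,3,4,1,2,2,2,2,1,2], [0,1,2,3,2,3,4,2,1,1,1,1,2,2], [0,1,2,3,2,3,4,2,1,3,3,3,2,4],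
      [0,1,2,3,2,3,4,2,3,1,3,3,4,2], [0,1,2,3,2,3,4,2,3,3,1,3,3,4], [0,1,2,3,4,0,1,1,0,2,0,0,1,1],
      [0,1,2,3,4,0,1,1,2,0,0,0,1,1], [0,1,2,3,4,0,1,2,1,1,1,1,4,0], [0,1,2,3,4,0,1,2,3,1,1,1,0,2],
      [0,1,2,3,4,0,1,2,3,1,1,1,2,0], [0,1,2,3,4,0,1,3,2,2,2,4,3,1], [0,1,2,3,4,0,1,3,2,2,4,2,1,3],
      [0,1,2,3,4,0,1,3,2,2,4,2,3,1], [0,1,2,3,4,0,1,3,2,4,2,2,3,1], [0,1,2,3,4,0,1,3,4,2,2,2,1,3],
      [0,1,2,3,4,0,1,3,4,2,2,2,3,1], [0,1,2,3,4,0,4,2,1,1,1,1,0,4], [0,1,2,3,4,0,4,2,1,1,1,3,4,0],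
      [0,1,2,3,4,0,4,2,1,1,3,1,0,4], [0,1,2,3,4,0,4,2,1,1,3,1,4,0], [0,1,2,3,4,0,4,2,1,1,3,3,4,0],
      [0,1,2,3,4,0,4,2,1,3,1,1,0,1], [0,1,2,3,4,0,4,2,1,3,1,3,4,0], [0,1,2,3,4,0,4,2,1,3,3,1,4,0],
      [0,1,2,3,4,0,4,2,1,3,3,3,0,4], [0,1,2,3,4,0,4,2,1,3,3,3,4,3], [0,1,2,3,4,0,4,2,3,1,1,1,1,0],
      [0,1,2,3,4,0,4,2,3,1,1,1,4,0], [0,1,2,3,4,0,4,2,3,1,3,1,4,0], [0,1,2,3,4,0,4,2,3,3,1,1,0,4],
      [0,1,2,3,4,0,4,2,3,3,1,1,4,0], [0,1,2,3,4,0,4,2,3,3,1,3,4,3], [0,1,2,3,4,0,4,2,3,3,3,1,0,4],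
      [0,1,2,3,4,0,4,2,3,3,3,1,3,4], [0,1,2,3,4,0,4,2,3,3,3,3,3,4], [0,1,2,3,4,0,4,4,0,0,3,0,1,4],
      [0,1,2,3,4,0,4,4,0,3,0,0,1,4], [0,1,2,3,4,3,4,3,4,4,4,4,3,0], [0,1,2,3,4,3,4,4,3,3,3,3,4,0],
      [0,4,0,1,2,3,4,0,1,1,1,4,4,0], [0,4,0,1,2,3,4,0,1,4,4,4,3,4], [0,4,0,1,2,3,4,0,4,1,1,1,4,0],
      [0,4,0,1,2,3,4,0,4,1,4,4,3,0], [0,4,0,1,2,3,4,0,4,1,4,4,4,3], [0,4,0,1,2,3,4,0,4,4,1,4,3,0],
      [0,4,0,1,2,3,4,0,4,4,1,4,3,4], [0,4,0,1,2,3,4,0,4,4,1,4,4,3], [0,4,0,1,2,3,4,2,1,1,1,1,0,4],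
      [0,4,0,1,2,3,4,2,1,1,1,3,4,0], [0,4,0,1,2,3,4,2,1,1,3,1,0,4], [0,4,0,1,2,3,4,2,1,1,3,3,4,4],
      [0,4,0,1,2,3,4,2,1,3,1,1,4,0], [0,4,0,1,2,3,4,2,1,3,1,3,0,4], [0,4,0,1,2,3,4,2,1,3,3,1,4,0],
      [0,4,0,1,2,3,4,2,1,3,3,1,4,4], [0,4,0,1,2,3,4,2,1,3,3,3,0,4], [0,4,0,1,2,3,4,2,1,3,3,3,4,2],
      [0,4,0,1,2,3,4,2,1,3,3,3,4,4], [0,4,0,1,2,3,4,2,3,1,1,1,4,0], [0,4,0,1,2,3,4,2,3,1,3,1,0,4],
      [0,4,0,1,2,3,4,2,3,1,3,1,4,0], [0,4,0,1,2,3,4,2,3,1,3,3,4,0], [0,4,0,1,2,3,4,2,3,3,1,1,4,0],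
      [0,4,0,1,2,3,4,2,3,3,1,3,0,4], [0,4,0,1,2,3,4,2,3,3,1,3,1,4], [0,4,0,1,2,3,4,2,3,3,1,3,4,0],
      [0,4,0,1,2,3,4,2,3,3,1,3,4,1], [0,4,0,1,2,3,4,2,3,3,1,3,4,4], [0,4,0,1,2,3,4,4,0,3,0,0,1,4],
      [0,4,0,4,3,2,1,0,4,4,4,4,3,4], [0,4,0,4,3,2,1,2,3,1,3,3,2,4], [0,4,0,4,3,2,1,2,3,1,3,3,4,2],
      [0,4,0,4,3,2,1,2,3,3,1,3,4,2], [0,4,0,4,3,2,1,4,0,0,0,3,4,4], [0,4,3,2,1,0,1,3,2,4,2,2,1,2],
      [0,4,3,2,1,0,1,3,2,4,2,4,0,1], [0,4,3,2,1,0,1,3,2,4,4,2,0,1], [0,4,3,2,1,0,1,3,2,4,4,2,1,0],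
      [0,4,3,2,1,0,1,3,4,2,2,2,1,0], [0,4,3,2,1,0,1,3,4,2,4,2,0,1], [0,4,3,2,1,0,1,3,4,2,4,4,0,1],
      [0,4,3,2,1,0,1,3,4,2,4,4,1,0], [0,4,3,2,1,0,1,3,4,4,2,2,0,1], [0,4,3,2,1,0,1,3,4,4,4,2,0,0],
      [0,4,3,2,1,0,1,3,4,4,4,2,0,1], [0,4,3,2,1,0,1,3,4,4,4,2,4,0], [0,4,3,2,1,0,1,4,0,0,0,0,0,4],
      [0,4,3,2,1,0,4,0,4,4,4,4,3,0], [0,4,3,2,1,0,4,1,0,0,0,0,4,3], [0,4,3,2,1,0,4,2,3,1,3,3,0,4],
      [0,4,3,2,1,0,4,2,3,1,3,3,4,2], [0,4,3,2,1,0,4,3,4,4,2,4,3,0], [0,4,3,2,1,2,1,0,1,1,1,1,0,2],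
      [0,4,3,2,1,2,1,0,1,1,1,1,2,3], [0,4,3,2,1,2,1,4,0,3,0,3,2,4], [0,4,3,2,1,2,1,4,0,3,3,3,4,2],
      [0,4,3,2,1,2,1,4,3,0,0,3,2,1], [0,4,3,2,1,2,1,4,3,0,3,0,4,2], [0,4,3,2,1,2,1,4,3,3,0,3,4,2],
      [0,4,3,2,3,2,1,0,1,1,1,1,3,2], [0,4,3,2,3,2,1,0,1,1,1,4,0,2], [0,4,3,2,3,2,1,0,1,1,1,4,1,2],
      [0,4,3,2,3,2,1,0,1,1,1,4,2,2], [0,4,3,2,3,2,1,0,1,1,1,4,2,3], [0,4,3,2,3,2,1,0,1,1,1,4,2,4],
      [0,4,3,2,3,2,1,0,1,1,4,1,2,0], [0,4,3,2,3,2,1,0,1,1,4,1,2,2], [0,4,3,2,3,2,1,0,1,1,4,4,2,0],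
      [0,4,3,2,3,2,1,0,1,1,4,4,3,2], [0,4,3,2,3,2,1,0,1,4,1,1,2,3], [0,4,3,2,3,2,1,0,1,4,1,4,0,2],
      [0,4,3,2,3,2,1,0,1,4,1,4,2,3], [0,4,3,2,3,2,1,0,1,4,1,4,3,2], [0,4,3,2,3,2,1,0,1,4,4,1,0,2],
      [0,4,3,2,3,2,1,0,1,4,4,1,2,0], [0,4,3,2,3,2,1,0,1,4,4,1,2,3], [0,4,3,2,3,2,1,0,1,4,4,4,3,2],
      [0,4,3,2,3,2,1,0,4,1,1,1,0,2], [0,4,3,2,3,2,1,0,4,1,1,1,2,2], [0,4,3,2,3,2,1,0,4,1,1,1,3,2],
      [0,4,3,2,3,2,1,0,4,1,1,4,0,2], [0,4,3,2,3,2,1,0,4,1,1,4,2,3], [0,4,3,2,3,2,1,0,4,1,1,4,3,2],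
      [0,4,3,2,3,2,1,0,4,1,4,1,2,0], [0,4,3,2,3,2,1,0,4,1,4,4,2,3], [0,4,3,2,3,2,1,0,4,4,1,1,0,2],
      [0,4,3,2,3,2,1,0,4,4,1,1,2,0], [0,4,3,2,3,2,1,0,4,4,1,1,3,2], [0,4,3,2,3,2,1,0,4,4,4,1,3,2],
      [0,4,3,2,3,2,1,0,4,4,4,4,0,3], [0,4,3,2,3,2,1,0,4,4,4,4,4,3], [0,4,3,2,3,2,1,3,2,2,4,2,1,3],
      [0,4,3,2,3,2,1,3,2,2,4,2,3,1], [0,4,3,2,3,2,1,3,2,4,2,2,2,1], [0,4,3,2,3,2,1,3,2,4,2,2,3,1],
      [0,4,3,2,3,2,1,3,4,2,2,2,1,3], [0,4,3,2,3,2,1,3,4,2,2,2,2,1], [0,4,3,4,3,2,1,0,4,1,1,4,2,0],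
      [0,4,3,4,3,2,1,1,0,0,2,2,4,4], [0,4,3,4,3,2,1,1,0,2,0,2,1,4], [0,4,3,4,3,2,1,1,2,0,2,0,3,4],
      [0,4,3,4,3,2,1,1,2,0,2,0,4,1], [0,4,3,4,3,2,1,3,2,2,2,4,1,2], [0,4,3,4,3,2,1,3,2,2,2,4,1,3],
      [0,4,3,4,3,2,1,3,2,2,2,4,3,1]]"
    by (rule no_colourings) simp
  note simps = edges[unfolded list.pred_inject prod.case]
    non_edges[unfolded list.pred_inject prod.case] eval_simps sym
  show False
    using walks[simplified simps]
      degrees[simplified simps]
      colourings[simplified simps]
    by sat
qed

text \<open>The largest case, with 42 unknown pairs: 9 between the positions 0, 2, 4 and the
  neighbours of \<open>v\<close>, and 33 that involve the remaining vertices 11, 12 and 13.\<close>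

lemma no_cycle_7_degree_3:
  assumes "m = 7" "d = 3"
  shows False
proof -
  have edges: "list_all (\<lambda>(i, j). E i j \<and> E j i) [
      (0,1), (6,0), (1,2), (2,3), (3,4), (4,5), (5,6), (7,8), (7,9), (7,10)]"
    by (rule edges) (simp add: assms)
  have non_edges: "list_all (\<lambda>(i, j). \<not> E i j \<and> \<not> E j i) [
      (0,2), (0,3), (0,4), (0,5), (0,7), (1,3), (1,4), (1,5), (1,6), (1,7), (2,4), (2,5), (2,6),
      (2,7), (3,5), (3,6), (3,7), (4,6), (4,7), (5,7), (6,7), (7,11), (7,12), (7,13), (8,9),
      (8,10), (9,10), (1,8), (1,9), (1,10), (3,8), (3,9), (3,10), (5,8), (5,9), (5,10), (6,8),
      (6,9), (6,10)]"
    by (rule non_edges) (simp add: assms)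
  have walks: "list_all (\<lambda>p. \<not> successively E (p @ [hd p])) [
      [0,1,11], [0,1,12], [0,1,13], [0,6,11], [0,6,12], [0,6,13], [1,2,11], [1,2,12], [1,2,13],
      [2,3,11], [2,3,12], [2,3,13], [3,4,11], [3,4,12], [3,4,13], [4,5,11], [4,5,12], [4,5,13],
      [5,6,11], [5,6,12], [5,6,13], [8,11,12], [8,11,13], [8,12,13], [9,11,12], [9,11,13],
      [9,12,13], [10,11,12], [10,11,13], [10,12,13], [11,12,13], [0,1,2,3,11], [0,1,2,3,12],
      [0,1,2,3,13], [0,1,2,8,11], [0,1,2,8,12], [0,1,2,8,13], [0,1,2,9,11], [0,1,2,9,12],
      [0,1,2,9,13], [0,1,2,10,11], [0,1,2,10,12], [0,1,2,10,13], [0,1,2,11,6], [0,1,2,11,8],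
      [0,1,2,11,9], [0,1,2,11,10], [0,1,2,11,12], [0,1,2,11,13], [0,1,2,12,6], [0,1,2,12,8],
      [0,1,2,12,9], [0,1,2,12,10], [0,1,2,12,11], [0,1,2,12,13], [0,1,2,13,6], [0,1,2,13,8],
      [0,1,2,13,9], [0,1,2,13,10], [0,1,2,13,11], [0,1,2,13,12], [0,1,11,5,6], [0,1,11,8,12],
      [0,1,11,8,13], [0,1,11,9,12], [0,1,11,9,13], [0,1,11,10,13], [0,1,11,12,6], [0,1,11,12,8],
      [0,1,11,12,9], [0,1,11,12,10], [0,1,11,12,13], [0,1,11,13,6], [0,1,11,13,8], [0,1,11,13,9],
      [0,1,11,13,10], [0,1,11,13,12], [0,1,12,5,6], [0,1,12,8,11], [0,1,12,8,13], [0,1,12,9,11],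
      [0,1,12,9,13], [0,1,12,10,11], [0,1,12,10,13], [0,1,12,11,6], [0,1,12,11,8], [0,1,12,11,9],
      [0,1,12,11,10], [0,1,12,11,13], [0,1,12,13,6], [0,1,12,13,8], [0,1,12,13,9], [0,1,12,13,10],
      [0,1,12,13,11], [0,1,13,5,6], [0,1,13,8,11], [0,1,13,8,12], [0,1,13,9,11], [0,1,13,9,12],
      [0,1,13,10,11], [0,1,13,10,12], [0,1,13,11,6], [0,1,13,11,8], [0,1,13,11,9], [0,1,13,11,10],
      [0,1,13,11,12], [0,1,13,12,6], [0,1,13,12,8], [0,1,13,12,9], [0,1,13,12,10], [0,1,13,12,11],
      [0,6,5,4,8], [0,6,5,4,9], [0,6,5,4,10], [0,6,5,4,11], [0,6,5,4,12], [0,6,5,4,13],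
      [0,6,5,11,8], [0,6,5,11,9], [0,6,5,11,10], [0,6,5,11,12], [0,6,5,11,13], [0,6,5,12,8],
      [0,6,5,12,9], [0,6,5,12,10], [0,6,5,12,11], [0,6,5,12,13], [0,6,5,13,8], [0,6,5,13,9],
      [0,6,5,13,10], [0,6,5,13,11], [0,6,5,13,12], [0,6,11,8,12], [0,6,11,8,13], [0,6,11,9,12],
      [0,6,11,9,13], [0,6,11,10,12], [0,6,11,10,13], [0,6,11,12,8], [0,6,11,12,9], [0,6,11,12,10],
      [0,6,11,12,13], [0,6,11,13,8], [0,6,11,13,9], [0,6,11,13,10], [0,6,11,13,12], [0,6,12,8,11],
      [0,6,12,8,13], [0,6,12,9,11], [0,6,12,9,13], [0,6,12,10,11], [0,6,12,10,13], [0,6,12,11,8],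
      [0,6,12,11,9], [0,6,12,11,10], [0,6,12,11,13], [0,6,12,13,8], [0,6,12,13,9], [0,6,12,13,10],
      [0,6,12,13,11], [0,6,13,8,11], [0,6,13,8,12], [0,6,13,9,11], [0,6,13,9,12], [0,6,13,10,11],
      [0,6,13,10,12], [0,6,13,11,8], [0,6,13,11,9], [0,6,13,11,10], [0,6,13,11,12], [0,6,13,12,8],
      [0,6,13,12,9], [0,6,13,12,10], [0,6,13,12,11], [1,2,3,4,11], [1,2,3,4,12], [1,2,3,4,13],
      [1,2,3,11,12], [1,2,3,11,13], [1,2,3,12,11], [1,2,3,12,13], [1,2,3,13,11], [1,2,3,13,12],
      [1,2,8,11,12], [1,2,8,11,13], [1,2,8,12,11], [1,2,8,12,13], [1,2,8,13,11], [1,2,8,13,12],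
      [1,2,9,11,12], [1,2,9,11,13], [1,2,9,12,11], [1,2,9,12,13], [1,2,9,13,11], [1,2,9,13,12],
      [1,2,10,11,12], [1,2,10,11,13], [1,2,10,12,11], [1,2,10,12,13], [1,2,10,13,11],
      [1,2,10,13,12], [1,2,11,8,12], [1,2,11,8,13], [1,2,11,9,12], [1,2,11,9,13], [1,2,11,10,12],
      [1,2,11,10,13], [1,2,11,12,13], [1,2,11,13,12], [1,2,12,8,11], [1,2,12,8,13], [1,2,12,9,11],
      [1,2,12,9,13], [1,2,12,10,11], [1,2,12,10,13], [1,2,12,11,13], [1,2,12,13,11],
      [1,2,13,8,11], [1,2,13,8,12], [1,2,13,9,11], [1,2,13,9,12], [1,2,13,10,11], [1,2,13,10,12],
      [1,2,13,11,12], [1,2,13,12,11], [2,3,4,5,11], [2,3,4,5,12], [2,3,4,5,13], [2,3,4,8,11],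
      [2,3,4,8,12], [2,3,4,8,13], [2,3,4,9,11], [2,3,4,9,12], [2,3,4,9,13], [2,3,4,10,11],
      [2,3,4,10,12], [2,3,4,10,13], [2,3,4,11,8], [2,3,4,11,9], [2,3,4,11,10], [2,3,4,11,12],
      [2,3,4,11,13], [2,3,4,12,8], [2,3,4,12,9], [2,3,4,12,10], [2,3,4,12,11], [2,3,4,12,13],
      [2,3,4,13,8], [2,3,4,13,9], [2,3,4,13,10], [2,3,4,13,11], [2,3,4,13,12], [2,3,11,8,12],
      [2,3,11,8,13], [2,3,11,9,12], [2,3,11,9,13], [2,3,11,10,12], [2,3,11,10,13], [2,3,11,12,8],
      [2,3,11,12,9], [2,3,11,12,10], [2,3,11,12,13], [2,3,11,13,8], [2,3,11,13,9], [2,3,11,13,10],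
      [2,3,11,13,12], [2,3,12,8,11], [2,3,12,8,13], [2,3,12,9,11], [2,3,12,9,13], [2,3,12,10,11],
      [2,3,12,10,13], [2,3,12,11,8], [2,3,12,11,9], [2,3,12,11,10], [2,3,12,11,13], [2,3,12,13,8],
      [2,3,12,13,9], [2,3,12,13,10], [2,3,12,13,11], [2,3,13,8,11], [2,3,13,8,12], [2,3,13,9,11],
      [2,3,13,9,12], [2,3,13,10,11], [2,3,13,10,12], [2,3,13,11,8], [2,3,13,11,9], [2,3,13,11,10],
      [2,3,13,11,12], [2,3,13,12,8], [2,3,13,12,9], [2,3,13,12,10], [2,3,13,12,11], [3,4,5,6,11],
      [3,4,5,6,12], [3,4,5,6,13], [3,4,5,11,12], [3,4,5,11,13], [3,4,5,12,11], [3,4,5,12,13],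
      [3,4,5,13,11], [3,4,5,13,12], [3,4,8,11,12], [3,4,8,11,13], [3,4,8,12,11], [3,4,8,12,13],
      [3,4,8,13,11], [3,4,8,13,12], [3,4,9,11,12], [3,4,9,11,13], [3,4,9,12,11], [3,4,9,12,13],
      [3,4,9,13,11], [3,4,9,13,12], [3,4,10,11,12], [3,4,10,11,13], [3,4,10,12,11],
      [3,4,10,12,13], [3,4,10,13,11], [3,4,10,13,12], [3,4,11,8,12], [3,4,11,8,13], [3,4,11,9,12],
      [3,4,11,9,13], [3,4,11,10,12], [3,4,11,10,13], [3,4,11,12,13], [3,4,11,13,12],
      [3,4,12,8,11], [3,4,12,8,13], [3,4,12,9,11], [3,4,12,9,13], [3,4,12,10,11], [3,4,12,10,13],
      [3,4,12,11,13], [3,4,12,13,11], [3,4,13,8,11], [3,4,13,8,12], [3,4,13,9,11], [3,4,13,9,12],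
      [3,4,13,10,11], [3,4,13,10,12], [3,4,13,11,12], [3,4,13,12,11], [4,5,6,11,8], [4,5,6,11,9],
      [4,5,6,11,10], [4,5,6,11,12], [4,5,6,11,13], [4,5,6,12,8], [4,5,6,12,9], [4,5,6,12,10],
      [4,5,6,12,11], [4,5,6,12,13], [4,5,6,13,8], [4,5,6,13,9], [4,5,6,13,10], [4,5,6,13,11],
      [4,5,6,13,12], [4,5,11,8,12], [4,5,11,8,13], [4,5,11,9,12], [4,5,11,9,13], [4,5,11,10,12],
      [4,5,11,10,13], [4,5,11,12,8], [4,5,11,12,9], [4,5,11,12,10], [4,5,11,12,13], [4,5,11,13,8],
      [4,5,11,13,9], [4,5,11,13,10], [4,5,11,13,12], [4,5,12,8,11], [4,5,12,8,13], [4,5,12,9,11],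
      [4,5,12,9,13], [4,5,12,10,11], [4,5,12,10,13], [4,5,12,11,8], [4,5,12,11,9], [4,5,12,11,10],
      [4,5,12,11,13], [4,5,12,13,8], [4,5,12,13,9], [4,5,12,13,10], [4,5,12,13,11], [4,5,13,8,11],
      [4,5,13,8,12], [4,5,13,9,11], [4,5,13,9,12], [4,5,13,10,11], [4,5,13,10,12], [4,5,13,11,8],
      [4,5,13,11,9], [4,5,13,11,10], [4,5,13,11,12], [4,5,13,12,8], [4,5,13,12,9], [4,5,13,12,10],
      [4,5,13,12,11], [5,6,11,8,12], [5,6,11,8,13], [5,6,11,9,12], [5,6,11,9,13], [5,6,11,10,12],
      [5,6,11,10,13], [5,6,11,12,13], [5,6,11,13,12], [5,6,12,8,11], [5,6,12,8,13], [5,6,12,9,11],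
      [5,6,12,10,11], [5,6,12,11,13], [5,6,12,13,11], [5,6,13,8,11], [5,6,13,8,12], [5,6,13,9,11],
      [5,6,13,9,12], [5,6,13,10,11], [5,6,13,10,12], [5,6,13,11,12], [5,6,13,12,11],
      [7,8,11,12,9], [7,8,11,12,10], [7,8,11,13,9], [7,8,11,13,10], [7,8,12,11,9], [7,8,12,11,10],
      [7,8,12,13,9], [7,8,12,13,10], [7,8,13,11,9], [7,8,13,11,10], [7,8,13,12,9], [7,8,13,12,10],
      [7,9,11,12,10], [7,9,11,13,10], [7,9,12,11,10], [7,9,12,13,10], [7,9,13,11,10],
      [7,9,13,12,10]]"
    by (rule no_short_walks) simp
  have degrees: "list_all (\<lambda>p. \<not> list_all (E (hd p)) (tl p)) [
      [0,1,6,8,9], [0,1,6,8,10], [0,1,6,8,11], [0,1,6,8,12], [0,1,6,8,13], [0,1,6,9,10],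
      [0,1,6,9,11], [0,1,6,9,12], [0,1,6,9,13], [0,1,6,10,11], [0,1,6,10,12], [0,1,6,10,13],
      [0,1,6,11,12], [0,1,6,11,13], [0,1,6,12,13], [1,0,2,11,12], [1,0,2,11,13], [1,0,2,12,13],
      [2,1,3,8,9], [2,1,3,8,10], [2,1,3,8,11], [2,1,3,8,12], [2,1,3,8,13], [2,1,3,9,10],
      [2,1,3,9,11], [2,1,3,9,12], [2,1,3,9,13], [2,1,3,10,11], [2,1,3,10,12], [2,1,3,10,13],
      [2,1,3,11,12], [2,1,3,11,13], [2,1,3,12,13], [3,2,4,11,12], [3,2,4,11,13], [3,2,4,12,13],
      [4,3,5,8,9], [4,3,5,8,10], [4,3,5,8,11], [4,3,5,8,12], [4,3,5,8,13], [4,3,5,9,10],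
      [4,3,5,9,11], [4,3,5,9,12], [4,3,5,9,13], [4,3,5,10,11], [4,3,5,10,12], [4,3,5,10,13],
      [4,3,5,11,12], [4,3,5,11,13], [4,3,5,12,13], [5,4,6,11,12], [5,4,6,11,13], [5,4,6,12,13],
      [6,0,5,11,12], [6,0,5,11,13], [6,0,5,12,13], [8,7,11,12,13], [9,7,11,12,13],
      [10,7,11,12,13], [11,0,2,8,9], [11,0,2,8,10], [11,0,2,9,10], [11,0,5,8,9], [11,0,5,8,10],
      [11,0,5,9,10], [11,0,8,9,10], [11,0,8,9,12], [11,0,8,9,13], [11,0,8,10,12], [11,0,8,10,13],
      [11,0,9,10,12], [11,0,9,10,13], [11,1,8,10,12], [11,1,8,10,13], [11,1,8,12,13],
      [11,1,9,12,13], [11,1,10,12,13], [11,2,4,8,9], [11,2,4,8,10], [11,2,4,9,10], [11,2,8,9,10],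
      [11,2,8,9,12], [11,2,8,9,13], [11,2,8,10,12], [11,2,8,10,13], [11,2,9,10,12],
      [11,2,9,10,13], [11,3,8,10,12], [11,3,8,10,13], [11,3,8,12,13], [11,3,9,12,13],
      [11,4,6,8,9], [11,4,6,8,10], [11,4,6,9,10], [11,4,8,9,12], [11,4,8,9,13], [11,4,8,10,12],
      [11,4,8,10,13], [11,4,9,10,12], [11,4,9,10,13], [11,5,8,9,10], [11,5,8,9,12], [11,5,8,9,13],
      [11,5,8,10,12], [11,5,8,10,13], [11,5,9,10,12], [11,5,9,10,13], [11,6,8,9,12],
      [11,6,8,9,13], [11,6,8,10,12], [11,6,8,10,13], [11,6,9,10,12], [11,6,9,10,13],
      [11,8,9,10,13], [11,8,9,12,13], [11,8,10,12,13], [11,9,10,12,13], [12,0,2,8,9],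
      [12,0,2,8,10], [12,0,2,9,10], [12,0,5,8,9], [12,0,5,8,10], [12,0,5,9,10], [12,0,8,9,13],
      [12,0,8,10,11], [12,0,8,10,13], [12,0,9,10,11], [12,0,9,10,13], [12,1,8,11,13],
      [12,1,9,11,13], [12,1,10,11,13], [12,2,4,8,9], [12,2,4,8,10], [12,2,4,9,10], [12,2,8,9,11],
      [12,2,8,9,13], [12,2,8,10,11], [12,2,8,10,13], [12,2,9,10,11], [12,2,9,10,13],
      [12,3,8,11,13], [12,3,9,11,13], [12,3,10,11,13], [12,4,6,8,9], [12,4,6,8,10], [12,4,6,9,10],
      [12,4,8,9,11], [12,4,8,9,13], [12,4,8,10,11], [12,4,8,10,13], [12,4,9,10,11],
      [12,4,9,10,13], [12,5,8,9,11], [12,5,8,9,13], [12,5,8,10,11], [12,5,8,10,13],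
      [12,5,9,10,11], [12,5,9,10,13], [12,6,8,9,11], [12,6,8,9,13], [12,6,8,10,11],
      [12,6,8,10,13], [12,6,9,10,11], [12,6,9,10,13], [12,8,9,10,11], [12,8,9,10,13],
      [12,8,9,11,13], [12,8,10,11,13], [12,9,10,11,13], [13,0,2,8,9], [13,0,5,8,9], [13,0,5,8,10],
      [13,0,5,9,10], [13,0,8,9,11], [13,0,8,9,12], [13,0,9,10,11], [13,0,9,10,12], [13,1,8,11,12],
      [13,1,9,10,12], [13,1,10,11,12], [13,2,4,8,9], [13,2,4,8,10], [13,2,4,9,10], [13,2,8,9,11],
      [13,2,8,9,12], [13,2,8,10,11], [13,2,8,10,12], [13,2,9,10,11], [13,2,9,10,12], [13,3,5,8,9],
      [13,3,8,9,10], [13,3,8,11,12], [13,3,9,11,12], [13,3,10,11,12], [13,4,6,8,9], [13,4,6,8,10],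
      [13,4,6,9,10], [13,4,8,9,11], [13,4,8,9,12], [13,4,8,10,11], [13,4,8,10,12], [13,4,9,10,11],
      [13,4,9,10,12], [13,5,8,9,11], [13,5,8,9,12], [13,5,8,10,12], [13,5,9,10,11],
      [13,5,9,10,12], [13,6,8,9,10], [13,6,8,9,12], [13,6,8,10,11], [13,6,8,10,12],
      [13,6,9,10,12], [13,8,9,10,11], [13,8,9,11,12], [13,8,10,11,12], [13,9,10,11,12]]"
    by (rule degrees) (simp add: assms)
  have colourings: "list_all (\<lambda>cs. \<not> sorted_wrt (\<lambda>(i, c) (j, c'). E i j \<longrightarrow> C5_adj c c')
    (zip [0, 1, 2, 3, 4, 5, 6, 7, 8, 9, 10, 11, 12, 13] cs)) [
      [0,1,0,1,2,3,4,0,1,1,1,0,4,0], [0,1,0,1,2,3,4,0,1,4,4,0,3,2], [0,1,0,1,2,3,4,0,1,4,4,2,0,3],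
      [0,1,0,1,2,3,4,0,4,4,1,0,2,3], [0,1,0,1,2,3,4,0,4,4,1,0,3,2], [0,1,0,1,2,3,4,0,4,4,1,3,2,0],
      [0,1,0,1,2,3,4,0,4,4,4,4,3,0], [0,1,0,1,2,3,4,1,2,2,0,0,1,1], [0,1,0,1,2,3,4,2,1,1,1,0,2,1],
      [0,1,0,1,2,3,4,2,1,1,1,0,2,2], [0,1,0,1,2,3,4,2,1,1,1,1,2,0], [0,1,0,1,2,3,4,2,1,3,1,0,4,2],
      [0,1,0,1,2,3,4,2,1,3,1,2,4,0], [0,1,0,1,2,3,4,2,1,3,1,4,0,2], [0,1,0,1,2,3,4,3,2,2,4,0,1,1],
      [0,1,0,1,2,3,4,3,2,2,4,0,3,1], [0,1,0,1,2,3,4,3,2,2,4,1,1,0], [0,1,0,1,2,3,4,3,2,2,4,1,3,0],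
      [0,1,0,1,2,3,4,3,2,2,4,2,1,3], [0,1,0,1,2,3,4,3,2,4,2,0,1,1], [0,1,0,1,2,3,4,3,2,4,2,1,0,3],
      [0,1,0,1,2,3,4,3,2,4,2,1,3,0], [0,1,0,1,2,3,4,3,2,4,2,2,3,1], [0,1,0,1,2,3,4,3,2,4,2,3,0,1],
      [0,1,0,1,2,3,4,3,2,4,2,3,1,0], [0,1,0,1,2,3,4,3,2,4,4,0,1,1], [0,1,0,1,2,3,4,3,2,4,4,1,0,3],
      [0,1,0,1,2,3,4,3,2,4,4,1,3,0], [0,1,0,1,2,3,4,3,2,4,4,3,0,1], [0,1,0,1,2,3,4,3,4,2,2,0,1,3],
      [0,1,0,1,2,3,4,3,4,2,4,0,1,3], [0,1,0,1,2,3,4,3,4,2,4,3,0,1], [0,1,0,1,2,3,4,3,4,4,2,0,3,1],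
      [0,1,0,1,2,3,4,3,4,4,2,1,0,1], [0,1,0,1,2,3,4,4,0,3,0,2,4,1], [0,1,0,1,2,3,4,4,0,3,0,4,1,2],
      [0,1,0,4,3,2,1,0,1,1,1,0,2,1], [0,1,0,4,3,2,1,0,4,4,4,0,2,3], [0,1,0,4,3,2,1,0,4,4,4,2,3,0],
      [0,1,0,4,3,2,1,1,0,2,0,3,4,1], [0,1,0,4,3,2,1,1,2,2,2,3,1,2], [0,1,0,4,3,2,1,2,1,1,1,2,0,0],
      [0,1,0,4,3,2,1,2,1,1,3,0,4,2], [0,1,0,4,3,2,1,2,1,1,3,4,0,2], [0,1,0,4,3,2,1,2,1,1,3,4,2,0],
      [0,1,0,4,3,2,1,2,1,3,1,2,4,0], [0,1,0,4,3,2,1,2,1,3,1,4,2,0], [0,1,0,4,3,2,1,2,3,1,1,0,4,2],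
      [0,1,0,4,3,2,1,2,3,1,1,2,4,0], [0,1,0,4,3,2,1,2,3,1,3,2,4,2], [0,1,0,4,3,2,1,3,2,2,4,0,1,0],
      [0,1,0,4,3,2,1,3,2,2,4,1,0,1], [0,1,0,4,3,2,1,3,2,2,4,1,3,0], [0,1,0,4,3,2,1,3,2,2,4,1,3,2],
      [0,1,0,4,3,2,1,3,2,4,2,0,1,1], [0,1,0,4,3,2,1,3,2,4,2,1,0,1], [0,1,0,4,3,2,1,3,2,4,2,1,3,2],
      [0,1,0,4,3,2,1,3,2,4,2,2,1,3], [0,1,0,4,3,2,1,3,2,4,2,3,1,2], [0,1,0,4,3,2,1,3,2,4,4,0,1,1],
      [0,1,0,4,3,2,1,3,2,4,4,1,0,0], [0,1,0,4,3,2,1,3,2,4,4,1,0,3], [0,1,0,4,3,2,1,3,2,4,4,1,1,0],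
      [0,1,0,4,3,2,1,3,2,4,4,3,0,1], [0,1,0,4,3,2,1,3,4,2,2,0,1,1], [0,1,0,4,3,2,1,3,4,2,2,1,1,0],
      [0,1,0,4,3,2,1,3,4,2,2,1,2,3], [0,1,0,4,3,2,1,3,4,2,2,1,3,2], [0,1,0,4,3,2,1,3,4,2,2,3,1,2],
      [0,1,0,4,3,2,1,3,4,2,4,0,0,1], [0,1,0,4,3,2,1,3,4,2,4,0,1,0], [0,1,0,4,3,2,1,3,4,2,4,0,3,1],
      [0,1,0,4,3,2,1,3,4,2,4,1,3,0], [0,1,0,4,3,2,1,3,4,4,2,0,1,0], [0,1,0,4,3,2,1,3,4,4,2,0,1,1],
      [0,1,0,4,3,2,1,3,4,4,2,0,3,1], [0,1,0,4,3,2,1,3,4,4,2,1,1,0], [0,1,0,4,3,2,1,3,4,4,4,3,2,0],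
      [0,1,2,1,2,3,4,0,1,1,1,0,1,2], [0,1,2,1,2,3,4,0,1,1,1,2,0,2], [0,1,2,1,2,3,4,0,1,1,1,2,2,0],
      [0,1,2,1,2,3,4,0,1,1,4,2,0,3], [0,1,2,1,2,3,4,0,1,1,4,2,3,0], [0,1,2,1,2,3,4,0,1,1,4,3,0,2],
      [0,1,2,1,2,3,4,0,1,4,1,0,2,3], [0,1,2,1,2,3,4,0,1,4,1,0,3,2], [0,1,2,1,2,3,4,0,1,4,1,2,3,0],
      [0,1,2,1,2,3,4,0,1,4,1,3,0,2], [0,1,2,1,2,3,4,0,1,4,1,3,2,0], [0,1,2,1,2,3,4,0,4,1,1,0,3,2],
      [0,1,2,1,2,3,4,0,4,4,4,0,0,3], [0,1,2,1,2,3,4,2,1,1,3,2,4,0], [0,1,2,1,2,3,4,2,3,3,3,4,2,3],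
      [0,1,2,1,2,3,4,3,2,2,2,3,1,1], [0,1,2,1,2,3,4,3,2,2,4,0,1,3], [0,1,2,1,2,3,4,3,2,2,4,3,0,1],
      [0,1,2,1,2,3,4,3,2,4,2,2,3,3], [0,1,2,1,2,3,4,3,4,2,2,1,0,3], [0,1,2,1,2,3,4,3,4,2,2,3,0,1],
      [0,1,2,1,2,3,4,4,0,0,3,1,1,2], [0,1,2,1,2,3,4,4,0,0,3,2,1,1], [0,1,2,1,2,3,4,4,0,0,3,2,1,4],
      [0,1,2,1,2,3,4,4,0,0,3,2,4,1], [0,1,2,1,2,3,4,4,0,3,0,0,1,4], [0,1,2,1,2,3,4,4,0,3,0,1,1,2],
      [0,1,2,1,2,3,4,4,0,3,0,1,2,1], [0,1,2,1,2,3,4,4,0,3,0,4,2,1], [0,1,2,1,2,3,4,4,0,3,3,1,1,2],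
      [0,1,2,1,2,3,4,4,0,3,3,1,2,4], [0,1,2,1,2,3,4,4,0,3,3,1,4,2], [0,1,2,1,2,3,4,4,0,3,3,2,4,1],
      [0,1,2,1,2,3,4,4,0,3,3,4,1,2], [0,1,2,1,2,3,4,4,3,0,3,1,1,2], [0,1,2,1,2,3,4,4,3,0,3,4,1,2],
      [0,1,2,1,2,3,4,4,3,3,0,2,1,1], [0,1,2,1,2,3,4,4,3,3,0,4,1,2], [0,1,2,1,2,3,4,4,3,3,0,4,4,0],
      [0,1,2,3,2,3,4,0,1,1,1,0,2,4], [0,1,2,3,2,3,4,0,1,1,1,2,1,1], [0,1,2,3,2,3,4,0,1,1,1,2,4,0],
      [0,1,2,3,2,3,4,0,1,1,4,0,3,2], [0,1,2,3,2,3,4,0,1,1,4,2,2,3], [0,1,2,3,2,3,4,0,1,1,4,2,3,3],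
      [0,1,2,3,2,3,4,0,1,1,4,3,2,3], [0,1,2,3,2,3,4,0,1,4,1,2,2,3], [0,1,2,3,2,3,4,0,1,4,1,2,3,2],
      [0,1,2,3,2,3,4,0,1,4,1,3,2,2], [0,1,2,3,2,3,4,0,1,4,4,0,4,3], [0,1,2,3,2,3,4,0,1,4,4,2,3,3],
      [0,1,2,3,2,3,4,0,1,4,4,3,4,0], [0,1,2,3,2,3,4,0,1,4,4,4,0,3], [0,1,2,3,2,3,4,0,1,4,4,4,3,0],
      [0,1,2,3,2,3,4,0,4,1,1,2,3,2], [0,1,2,3,2,3,4,0,4,1,1,2,3,3], [0,1,2,3,2,3,4,0,4,1,1,3,2,2],
      [0,1,2,3,2,3,4,0,4,1,1,3,3,2], [0,1,2,3,2,3,4,0,4,1,4,0,3,2], [0,1,2,3,2,3,4,0,4,1,4,2,3,3],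
      [0,1,2,3,2,3,4,0,4,1,4,3,2,3], [0,1,2,3,2,3,4,0,4,1,4,3,3,2], [0,1,2,3,2,3,4,0,4,1,4,3,4,0],
      [0,1,2,3,2,3,4,0,4,1,4,4,0,3], [0,1,2,3,2,3,4,0,4,1,4,4,3,0], [0,1,2,3,2,3,4,0,4,4,1,2,3,3],
      [0,1,2,3,2,3,4,0,4,4,1,3,0,4], [0,1,2,3,2,3,4,0,4,4,1,3,3,2], [0,1,2,3,2,3,4,0,4,4,1,3,4,0],
      [0,1,2,3,2,3,4,0,4,4,1,4,0,3], [0,1,2,3,2,3,4,0,4,4,1,4,3,0], [0,1,2,3,2,3,4,0,4,4,4,1,3,0],
      [0,1,2,3,2,3,4,0,4,4,4,3,2,3], [0,1,2,3,2,3,4,1,2,0,2,3,1,4], [0,1,2,3,2,3,4,1,2,2,2,3,1,2],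
      [0,1,2,3,2,3,4,2,1,1,1,2,0,4], [0,1,2,3,2,3,4,2,3,3,3,2,4,2], [0,1,2,3,2,3,4,3,4,4,4,3,3,3],
      [0,1,2,3,2,3,4,4,0,3,3,2,1,4], [0,1,2,3,2,3,4,4,0,3,3,4,2,1], [0,1,2,3,2,3,4,4,3,3,0,1,2,4],
      [0,1,2,3,2,3,4,4,3,3,0,2,4,1], [0,1,2,3,2,3,4,4,3,3,0,4,2,1], [0,1,2,3,2,3,4,4,3,3,3,2,3,4],
      [0,1,2,3,4,0,1,0,4,1,4,2,3,0], [0,1,2,3,4,0,1,0,4,4,4,3,0,4], [0,1,2,3,4,0,1,1,0,0,0,1,0,4],
      [0,1,2,3,4,0,1,1,0,2,2,1,3,4], [0,1,2,3,4,0,1,2,1,1,1,2,1,0], [0,1,2,3,4,0,1,2,1,1,3,2,4,0],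
      [0,1,2,3,4,0,1,2,1,3,1,0,2,4], [0,1,2,3,4,0,1,2,3,1,1,2,0,4], [0,1,2,3,4,0,1,2,3,1,1,4,0,2],
      [0,1,2,3,4,0,1,3,2,2,4,0,1,1], [0,1,2,3,4,0,1,3,2,2,4,1,0,1], [0,1,2,3,4,0,1,3,2,4,2,2,1,3],
      [0,1,2,3,4,0,1,3,2,4,4,0,1,3], [0,1,2,3,4,0,1,3,2,4,4,0,3,1], [0,1,2,3,4,0,1,3,2,4,4,1,3,0],
      [0,1,2,3,4,0,1,3,4,2,2,0,1,1], [0,1,2,3,4,0,1,3,4,2,2,1,1,0], [0,1,2,3,4,0,1,3,4,2,4,0,1,3],
      [0,1,2,3,4,0,1,3,4,4,2,0,1,3], [0,1,2,3,4,0,1,4,0,0,0,0,1,4], [0,1,2,3,4,0,1,4,0,0,0,1,4,1],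
      [0,1,2,3,4,0,1,4,0,0,3,2,4,1], [0,1,2,3,4,0,1,4,0,3,0,4,2,1], [0,1,2,3,4,0,4,1,0,0,2,3,4,1],
      [0,1,2,3,4,0,4,1,0,0,2,4,1,3], [0,1,2,3,4,0,4,1,0,2,0,1,4,3], [0,1,2,3,4,0,4,1,0,2,0,3,1,4],
      [0,1,2,3,4,0,4,1,0,2,0,4,1,3], [0,1,2,3,4,0,4,1,2,0,0,3,1,4], [0,1,2,3,4,0,4,1,2,0,0,3,4,1],
      [0,1,2,3,4,0,4,2,1,1,1,0,3,2], [0,1,2,3,4,0,4,2,1,1,1,2,0,3], [0,1,2,3,4,0,4,2,1,1,1,3,2,0],
      [0,1,2,3,4,0,4,2,1,1,3,0,0,4], [0,1,2,3,4,0,4,2,1,1,3,0,2,4], [0,1,2,3,4,0,4,2,1,1,3,4,0,0],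
      [0,1,2,3,4,0,4,2,1,3,1,0,4,0], [0,1,2,3,4,0,4,2,1,3,3,2,0,4], [0,1,2,3,4,0,4,2,1,3,3,4,4,0],
      [0,1,2,3,4,0,4,2,3,1,1,4,0,0], [0,1,2,3,4,0,4,2,3,1,1,4,4,0], [0,1,2,3,4,0,4,2,3,1,3,4,4,0],
      [0,1,2,3,4,0,4,2,3,3,1,4,0,4], [0,1,2,3,4,0,4,2,3,3,1,4,2,0], [0,1,2,3,4,0,4,2,3,3,1,4,4,0],
      [0,1,2,3,4,0,4,2,3,3,3,1,2,4], [0,1,2,3,4,0,4,2,3,3,3,2,1,4], [0,1,2,3,4,0,4,3,2,4,4,1,0,3],
      [0,1,2,3,4,0,4,3,2,4,4,3,0,1], [0,1,2,3,4,0,4,3,2,4,4,3,1,0], [0,1,2,3,4,0,4,3,4,4,2,0,3,1],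
      [0,1,2,3,4,0,4,3,4,4,2,1,0,3], [0,1,2,3,4,0,4,3,4,4,2,1,3,0], [0,1,2,3,4,0,4,3,4,4,2,3,1,0],
      [0,1,2,3,4,0,4,4,3,3,3,2,4,1], [0,1,2,3,4,0,4,4,3,3,3,4,2,1], [0,1,2,3,4,3,4,0,1,4,4,3,0,2],
      [0,1,2,3,4,3,4,0,4,4,4,3,3,2], [0,1,2,3,4,3,4,1,0,0,2,1,3,4], [0,1,2,3,4,3,4,1,0,2,0,1,3,4],
      [0,1,2,3,4,3,4,1,0,2,0,4,3,1], [0,1,2,3,4,3,4,1,0,2,2,3,3,4], [0,1,2,3,4,3,4,1,0,2,2,3,4,3],
      [0,1,2,3,4,3,4,1,0,2,2,4,1,3], [0,1,2,3,4,3,4,1,2,0,0,1,4,3], [0,1,2,3,4,3,4,1,2,0,0,4,1,3],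
      [0,1,2,3,4,3,4,1,2,0,2,3,1,2], [0,1,2,3,4,3,4,1,2,0,2,3,3,4], [0,1,2,3,4,3,4,1,2,0,2,4,3,3],
      [0,1,2,3,4,3,4,1,2,2,0,2,1,3], [0,1,2,3,4,3,4,1,2,2,0,3,4,3], [0,1,2,3,4,3,4,3,2,2,4,3,1,0],
      [0,1,2,3,4,3,4,3,4,2,2,3,1,0], [0,1,2,3,4,3,4,3,4,2,4,3,4,3], [0,4,0,1,2,3,4,0,1,1,1,0,2,3],
      [0,4,0,1,2,3,4,0,4,4,1,2,0,3], [0,4,0,1,2,3,4,0,4,4,4,0,3,3], [0,4,0,1,2,3,4,1,0,0,0,2,1,1],
      [0,4,0,1,2,3,4,1,0,0,0,4,1,4], [0,4,0,1,2,3,4,1,2,0,2,3,1,1], [0,4,0,1,2,3,4,2,1,1,1,2,0,3],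
      [0,4,0,1,2,3,4,2,1,1,1,3,0,2], [0,4,0,1,2,3,4,2,1,1,3,0,0,4], [0,4,0,1,2,3,4,2,1,1,3,0,4,2],
      [0,4,0,1,2,3,4,2,1,1,3,2,0,4], [0,4,0,1,2,3,4,2,1,1,3,2,4,0], [0,4,0,1,2,3,4,2,1,1,3,4,0,0],
      [0,4,0,1,2,3,4,2,1,1,3,4,0,4], [0,4,0,1,2,3,4,2,1,1,3,4,2,0], [0,4,0,1,2,3,4,2,1,3,1,0,4,4],
      [0,4,0,1,2,3,4,2,1,3,1,2,0,4], [0,4,0,1,2,3,4,2,1,3,1,4,0,0], [0,4,0,1,2,3,4,2,1,3,1,4,0,4],
      [0,4,0,1,2,3,4,2,1,3,1,4,4,0], [0,4,0,1,2,3,4,2,1,3,3,0,0,4], [0,4,0,1,2,3,4,2,1,3,3,2,3,4],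
      [0,4,0,1,2,3,4,2,1,3,3,3,4,2], [0,4,0,1,2,3,4,2,1,3,3,4,0,4], [0,4,0,1,2,3,4,2,3,1,1,0,0,4],
      [0,4,0,1,2,3,4,2,3,1,1,0,2,4], [0,4,0,1,2,3,4,2,3,1,1,0,4,0], [0,4,0,1,2,3,4,2,3,1,1,4,0,4],
      [0,4,0,1,2,3,4,2,3,1,3,0,0,4], [0,4,0,1,2,3,4,2,3,1,3,0,2,4], [0,4,0,1,2,3,4,2,3,1,3,4,0,2],
      [0,4,0,1,2,3,4,2,3,1,3,4,2,0], [0,4,0,1,2,3,4,2,3,1,3,4,3,2], [0,4,0,1,2,3,4,2,3,1,3,4,4,0],
      [0,4,0,1,2,3,4,2,3,3,1,0,4,2], [0,4,0,1,2,3,4,2,3,3,1,0,4,4], [0,4,0,1,2,3,4,2,3,3,1,2,3,4],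
      [0,4,0,1,2,3,4,2,3,3,1,2,4,3], [0,4,0,1,2,3,4,2,3,3,1,4,0,0], [0,4,0,1,2,3,4,2,3,3,1,4,0,2],
      [0,4,0,1,2,3,4,2,3,3,1,4,3,2], [0,4,0,1,2,3,4,2,3,3,1,4,4,0], [0,4,0,1,2,3,4,2,3,3,3,2,1,4],
      [0,4,0,1,2,3,4,2,3,3,3,2,4,1], [0,4,0,1,2,3,4,2,3,3,3,4,4,0], [0,4,0,1,2,3,4,3,2,4,4,0,3,1],
      [0,4,0,1,2,3,4,3,4,2,4,0,3,1], [0,4,0,1,2,3,4,3,4,4,2,3,1,0], [0,4,0,1,2,3,4,3,4,4,4,3,0,4],
      [0,4,0,1,2,3,4,3,4,4,4,3,4,0], [0,4,0,1,2,3,4,4,3,0,0,2,1,4], [0,4,0,1,2,3,4,4,3,0,0,4,2,1],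
      [0,4,0,4,3,2,1,0,1,4,1,0,3,2], [0,4,0,4,3,2,1,0,1,4,1,3,0,2], [0,4,0,4,3,2,1,0,4,1,1,0,3,2],
      [0,4,0,4,3,2,1,1,2,2,2,3,1,1], [0,4,0,4,3,2,1,2,1,1,3,2,0,4], [0,4,0,4,3,2,1,2,1,3,1,4,0,2],
      [0,4,0,4,3,2,1,2,1,3,1,4,0,4], [0,4,0,4,3,2,1,2,1,3,3,0,4,4], [0,4,0,4,3,2,1,2,1,3,3,3,4,2],
      [0,4,0,4,3,2,1,2,1,3,3,4,0,4], [0,4,0,4,3,2,1,2,1,3,3,4,4,0], [0,4,0,4,3,2,1,2,3,1,1,4,0,4],
      [0,4,0,4,3,2,1,2,3,1,3,4,0,4], [0,4,0,4,3,2,1,2,3,1,3,4,4,0], [0,4,0,4,3,2,1,2,3,3,1,4,0,4],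
      [0,4,0,4,3,2,1,2,3,3,3,2,3,4], [0,4,0,4,3,2,1,3,2,2,2,1,1,3], [0,4,0,4,3,2,1,3,2,2,2,3,1,3],
      [0,4,0,4,3,2,1,3,2,4,4,0,1,3], [0,4,0,4,3,2,1,3,2,4,4,1,3,0], [0,4,0,4,3,2,1,3,2,4,4,3,1,0],
      [0,4,0,4,3,2,1,3,4,4,2,1,0,3], [0,4,0,4,3,2,1,3,4,4,4,4,0,3], [0,4,0,4,3,2,1,4,0,0,0,1,3,4],
      [0,4,0,4,3,2,1,4,0,0,0,4,1,0], [0,4,0,4,3,2,1,4,0,0,0,4,1,1], [0,4,3,2,1,0,1,0,1,1,1,0,2,1],
      [0,4,3,2,1,0,1,0,4,4,4,0,3,2], [0,4,3,2,1,0,1,0,4,4,4,3,2,0], [0,4,3,2,1,0,1,1,0,0,0,0,1,4],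
      [0,4,3,2,1,0,1,1,2,2,2,1,4,3], [0,4,3,2,1,0,1,1,2,2,2,4,1,3], [0,4,3,2,1,0,1,3,2,2,2,1,1,1],
      [0,4,3,2,1,0,1,3,2,2,4,0,1,0], [0,4,3,2,1,0,1,3,2,2,4,0,1,1], [0,4,3,2,1,0,1,3,2,2,4,3,0,1],
      [0,4,3,2,1,0,1,3,2,4,2,0,0,1], [0,4,3,2,1,0,1,3,2,4,2,0,1,1], [0,4,3,2,1,0,1,3,2,4,2,1,0,0],
      [0,4,3,2,1,0,1,3,2,4,2,1,0,1], [0,4,3,2,1,0,1,3,2,4,2,1,3,0], [0,4,3,2,1,0,1,3,2,4,4,0,0,1],
      [0,4,3,2,1,0,1,3,2,4,4,0,1,0], [0,4,3,2,1,0,1,3,4,2,2,0,1,1], [0,4,3,2,1,0,1,3,4,2,2,0,1,3],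
      [0,4,3,2,1,0,1,3,4,2,2,1,0,0], [0,4,3,2,1,0,1,3,4,2,2,1,0,1], [0,4,3,2,1,0,1,3,4,2,4,0,0,1],
      [0,4,3,2,1,0,1,3,4,2,4,0,1,3], [0,4,3,2,1,0,1,3,4,2,4,1,0,0], [0,4,3,2,1,0,1,3,4,4,2,0,1,0],
      [0,4,3,2,1,0,1,3,4,4,2,1,1,0], [0,4,3,2,1,0,1,3,4,4,4,2,0,3], [0,4,3,2,1,0,1,4,0,0,3,1,2,4],
      [0,4,3,2,1,0,1,4,0,0,3,2,4,4], [0,4,3,2,1,0,1,4,0,3,0,2,1,4], [0,4,3,2,1,0,1,4,3,3,3,2,2,4],
      [0,4,3,2,1,0,4,0,1,4,4,1,0,0], [0,4,3,2,1,0,4,0,4,4,4,4,3,0], [0,4,3,2,1,0,4,1,0,0,0,4,3,4],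
      [0,4,3,2,1,0,4,1,0,0,2,1,3,4], [0,4,3,2,1,0,4,1,2,0,0,1,3,4], [0,4,3,2,1,0,4,1,2,0,0,3,1,4],
      [0,4,3,2,1,0,4,2,1,1,3,2,0,4], [0,4,3,2,1,0,4,2,1,3,1,0,2,4], [0,4,3,2,1,0,4,2,1,3,1,2,0,4],
      [0,4,3,2,1,0,4,2,1,3,1,2,4,0], [0,4,3,2,1,0,4,2,1,3,1,4,0,2], [0,4,3,2,1,0,4,2,1,3,1,4,2,0],
      [0,4,3,2,1,0,4,2,1,3,3,4,0,4], [0,4,3,2,1,0,4,2,1,3,3,4,4,2], [0,4,3,2,1,0,4,2,3,1,3,0,4,4],
      [0,4,3,2,1,0,4,2,3,1,3,3,2,4], [0,4,3,2,1,0,4,2,3,1,3,4,0,4], [0,4,3,2,1,0,4,2,3,1,3,4,2,2],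
      [0,4,3,2,1,0,4,2,3,1,3,4,4,0], [0,4,3,2,1,0,4,2,3,3,1,4,4,0], [0,4,3,2,1,0,4,3,2,4,4,0,1,3],
      [0,4,3,2,1,0,4,3,2,4,4,0,3,1], [0,4,3,2,1,0,4,3,4,2,4,1,0,3], [0,4,3,2,1,0,4,3,4,4,2,1,0,3],
      [0,4,3,2,1,0,4,3,4,4,2,3,0,1], [0,4,3,2,1,0,4,3,4,4,4,0,1,0], [0,4,3,2,1,0,4,4,0,0,0,1,0,4],
      [0,4,3,2,1,2,1,0,1,4,1,2,0,3], [0,4,3,2,1,2,1,0,4,1,1,2,3,0], [0,4,3,2,1,2,1,1,2,2,2,3,1,2],
      [0,4,3,2,1,2,1,2,1,1,1,1,0,2], [0,4,3,2,1,2,1,3,2,2,2,1,2,3], [0,4,3,2,1,2,1,3,2,2,4,3,1,0],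
      [0,4,3,2,1,2,1,3,2,4,2,0,1,3], [0,4,3,2,1,2,1,3,2,4,2,3,1,0], [0,4,3,2,1,2,1,3,4,2,2,1,3,0],
      [0,4,3,2,1,2,1,3,4,2,2,3,1,0], [0,4,3,2,1,2,1,4,0,0,3,4,1,2], [0,4,3,2,1,2,1,4,0,3,3,1,2,2],
      [0,4,3,2,1,2,1,4,0,3,3,2,4,1], [0,4,3,2,1,2,1,4,3,0,0,1,2,4], [0,4,3,2,1,2,1,4,3,0,0,4,2,1],
      [0,4,3,2,1,2,1,4,3,0,3,2,1,2], [0,4,3,2,1,2,1,4,3,0,3,2,1,4], [0,4,3,2,1,2,1,4,3,3,0,1,2,2],
      [0,4,3,2,1,2,1,4,3,3,0,2,2,1], [0,4,3,2,3,2,1,0,1,1,1,0,4,2], [0,4,3,2,3,2,1,0,1,1,4,0,1,2],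
      [0,4,3,2,3,2,1,0,1,1,4,2,0,3], [0,4,3,2,3,2,1,0,1,1,4,2,3,2], [0,4,3,2,3,2,1,0,1,4,1,2,0,1],
      [0,4,3,2,3,2,1,0,1,4,1,3,2,3], [0,4,3,2,3,2,1,0,1,4,4,2,3,0], [0,4,3,2,3,2,1,0,1,4,4,2,3,2],
      [0,4,3,2,3,2,1,0,1,4,4,3,3,2], [0,4,3,2,3,2,1,0,4,1,1,2,0,1], [0,4,3,2,3,2,1,0,4,1,1,2,2,3],
      [0,4,3,2,3,2,1,0,4,1,1,2,3,2], [0,4,3,2,3,2,1,0,4,1,4,2,2,3], [0,4,3,2,3,2,1,0,4,1,4,2,3,2],
      [0,4,3,2,3,2,1,0,4,4,1,2,2,3], [0,4,3,2,3,2,1,0,4,4,1,2,3,3], [0,4,3,2,3,2,1,0,4,4,1,3,2,3],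
      [0,4,3,2,3,2,1,0,4,4,4,1,3,0], [0,4,3,2,3,2,1,0,4,4,4,3,4,3], [0,4,3,2,3,2,1,1,2,0,2,4,3,1],
      [0,4,3,2,3,2,1,2,1,1,1,4,0,2], [0,4,3,2,3,2,1,2,3,3,1,4,0,2], [0,4,3,2,3,2,1,3,2,2,2,1,3,3],
      [0,4,3,2,3,2,1,3,4,4,4,0,1,3], [0,4,3,2,3,2,1,3,4,4,4,1,0,3], [0,4,3,2,3,2,1,4,3,3,3,4,2,3],
      [0,4,3,2,3,2,1,4,3,3,3,4,4,2], [0,4,3,4,3,2,1,0,1,1,1,2,0,2], [0,4,3,4,3,2,1,0,1,4,4,0,3,2],
      [0,4,3,4,3,2,1,0,1,4,4,2,0,3], [0,4,3,4,3,2,1,0,1,4,4,3,0,2], [0,4,3,4,3,2,1,0,1,4,4,3,2,0],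
      [0,4,3,4,3,2,1,0,4,1,4,3,0,2], [0,4,3,4,3,2,1,0,4,1,4,3,2,2], [0,4,3,4,3,2,1,0,4,4,1,0,3,2],
      [0,4,3,4,3,2,1,0,4,4,1,2,3,0], [0,4,3,4,3,2,1,0,4,4,4,3,0,4], [0,4,3,4,3,2,1,1,0,0,0,4,0,4],
      [0,4,3,4,3,2,1,1,0,0,2,1,3,4], [0,4,3,4,3,2,1,1,0,0,2,1,4,3], [0,4,3,4,3,2,1,1,0,0,2,4,1,3],
      [0,4,3,4,3,2,1,1,0,0,2,4,3,1], [0,4,3,4,3,2,1,1,0,0,2,4,3,4], [0,4,3,4,3,2,1,1,0,2,0,3,4,4],
      [0,4,3,4,3,2,1,1,2,0,0,0,4,1], [0,4,3,4,3,2,1,1,2,0,0,1,4,0], [0,4,3,4,3,2,1,1,2,0,0,3,4,4],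
      [0,4,3,4,3,2,1,1,2,0,0,4,3,1], [0,4,3,4,3,2,1,1,2,0,0,4,3,3], [0,4,3,4,3,2,1,1,2,0,0,4,3,4],
      [0,4,3,4,3,2,1,1,2,0,0,4,4,3], [0,4,3,4,3,2,1,1,2,0,2,1,3,4], [0,4,3,4,3,2,1,1,2,0,2,3,1,4],
      [0,4,3,4,3,2,1,1,2,0,2,3,4,1], [0,4,3,4,3,2,1,1,2,0,2,4,1,3], [0,4,3,4,3,2,1,1,2,2,0,3,4,1],
      [0,4,3,4,3,2,1,1,2,2,0,4,1,3], [0,4,3,4,3,2,1,1,2,2,0,4,4,3], [0,4,3,4,3,2,1,1,2,2,2,2,3,1],
      [0,4,3,4,3,2,1,2,1,1,1,0,2,0], [0,4,3,4,3,2,1,2,1,3,3,0,2,4], [0,4,3,4,3,2,1,2,1,3,3,4,2,0],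
      [0,4,3,4,3,2,1,2,3,1,3,0,2,4], [0,4,3,4,3,2,1,3,2,2,2,2,1,3], [0,4,3,4,3,2,1,3,2,2,4,0,3,1],
      [0,4,3,4,3,2,1,3,2,4,2,1,0,3], [0,4,3,4,3,2,1,3,4,2,2,1,0,3], [0,4,3,4,3,2,1,4,3,3,3,4,2,4]]"
    by (rule no_colourings) simp
  note simps = edges[unfolded list.pred_inject prod.case]
    non_edges[unfolded list.pred_inject prod.case] eval_simps sym
  show False
    using walks[simplified simps]
      degrees[simplified simps]
      colourings[simplified simps]
    by sat
qed

end

section \<open>Graphs with 14 vertices\<close>

lemma successively_relpowp:
  "successively E (x # xs @ [y]) \<Longrightarrow> (E ^^ Suc (length xs)) x y"
proof (induction xs arbitrary: x)
  case (Cons z zs)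
  then have "E x z" "(E ^^ Suc (length zs)) z y" by auto
  then show ?case by (simp only: list.size add_Suc_right add_0_right relpowp_Suc_I2)
qed auto

text \<open>In a maximal independent set of a 7-cycle consecutive elements are 2 or 3 apart, and 7 =
  2 + 2 + 3 is the only such decomposition. So up to rotation every independent set lies in {0, 2,
  4}, the complement of the positions in the statement.\<close>

lemma rotate_independent_set_C7:
  assumes "\<And>i. i < 7 \<Longrightarrow> \<not> (P i \<and> P (Suc i mod 7))"
  shows "\<exists>r. \<forall>i\<in>{1, 3, 5, 6}. \<not> P ((i + r) mod 7)"
proof -
  have "\<not> (P 0 \<and> P 1)" "\<not> (P 1 \<and> P 2)" "\<not> (P 2 \<and> P 3)" "\<not> (P 3 \<and> P 4)"
    "\<not> (P 4 \<and> P 5)" "\<not> (P 5 \<and> P 6)" "\<not> (P 6 \<and> P 0)"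
    using assms[of 0] assms[of 1] assms[of 2] assms[of 3] assms[of 4] assms[of 5] assms[of 6]
    by (simp_all flip: numeral_2_eq_2)
  then have "\<exists>r\<in>{0, 1, 2, 3, 4, 5, 6}. \<forall>i\<in>{1, 3, 5, 6}. \<not> P ((i + r) mod 7)"
    by (simp flip: numeral_2_eq_2) sat
  then show ?thesis by blast
qed

lemma mod_add_right_cancel_nat:
  fixes i j :: nat
  shows "(i + r) mod m = (j + r) mod m \<longleftrightarrow> i mod m = j mod m"
proof (induction i j rule: linorder_wlog)
  case (le i j)
  then show ?case
    using mod_eq_dvd_iff_nat[of i j m] mod_eq_dvd_iff_nat[of "i + r" "j + r" m] by auto
qed auto

context non_C5_colourable
begin

lemma rotated_odd_cycle_avoiding:
  obtains m c where "odd m" "7 \<le> m" "inj_on c {..<m}"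
    "\<And>i j. i < m \<Longrightarrow> j < m \<Longrightarrow> E (c i) (c j) \<longleftrightarrow> j = Suc i mod m \<or> i = Suc j mod m"
    "c ` {..<m} \<subseteq> V - insert v {y. E v y}"
    "\<And>i a. m = 7 \<Longrightarrow> i \<in> {1, 3, 5, 6} \<Longrightarrow> E v a \<Longrightarrow> \<not> E (c i) a"
proof -
  obtain m c where c: "odd m" "7 \<le> m" "inj_on c {..<m}"
    "\<And>i j. i < m \<Longrightarrow> j < m \<Longrightarrow> E (c i) (c j) \<longleftrightarrow> j = Suc i mod m \<or> i = Suc j mod m"
    "c ` {..<m} \<subseteq> V - insert v {y. E v y}"
    by (rule odd_cycle_avoiding[of v]) blast
  show thesis
  proof (cases "m = 7")
    case False
    show thesis by (rule that[OF c]) (use False in auto)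
  next
    case True
    define P where "P i \<longleftrightarrow> (\<exists>a. E v a \<and> E (c i) a)" for i
    have "\<not> (P i \<and> P (Suc i mod 7))" if "i < 7" for i
    proof
      assume "P i \<and> P (Suc i mod 7)"
      then obtain a b where "E v a" "E a (c i)" "E v b" "E (c (Suc i mod 7)) b"
        unfolding P_def using symD by blast
      moreover have "E (c i) (c (Suc i mod 7))" using c(4) that True by simp
      ultimately show False using no_pentagon symD by blast
    qed
    then obtain r where r: "\<forall>i\<in>{1, 3, 5, 6}. \<not> P ((i + r) mod 7)"
      using rotate_independent_set_C7 by blast
    \<comment> \<open>Shifting indices commutes with the successor modulo 7, so the rotated
      labelling is again that of a chordless cycle.\<close>
    let ?c = "\<lambda>i. c ((i + r) mod 7)"
    show thesis
    proof (rule that[of 7 ?c])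
      show "inj_on ?c {..<7}"
      proof (rule inj_onI)
        fix i j assume ij: "i \<in> {..<7}" "j \<in> {..<7}" "?c i = ?c j"
        then have "(i + r) mod 7 = (j + r) mod 7" using inj_onD[OF c(3)] True by simp
        then show "i = j" using ij unfolding mod_add_right_cancel_nat by simp
      qed
      show "E (?c i) (?c j) \<longleftrightarrow> j = Suc i mod 7 \<or> i = Suc j mod 7" if "i < 7" "j < 7" for i j
      proof -
        have "(l + r) mod 7 = Suc ((k + r) mod 7) mod 7 \<longleftrightarrow> l = Suc k mod 7" if "l < 7" for k l
          using mod_add_right_cancel_nat[of l r 7 "Suc k"] that by (simp add: mod_Suc_eq)
        then show ?thesis
          using c(4)[of "(i + r) mod 7" "(j + r) mod 7"] that True by simp
      qed
      show "?c ` {..<7} \<subseteq> V - insert v {y. E v y}"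
      proof -
        have "(i + r) mod 7 \<in> {..<m}" for i using True by simp
        then show ?thesis using c(5) by blast
      qed
    qed (use r in \<open>auto simp: P_def\<close>)
  qed
qed

text \<open>Exactly 14 elements mean that the labels below 14 correspond one to one to the vertices.
  Isolated vertices in \<open>V\<close> make this cover smaller graphs.\<close>

lemma card_V_neq_14: "card V \<noteq> 14"
proof
  assume card_V: "card V = 14"
  let ?N = "\<lambda>x. {y. E x y}"
  have N_V: "?N x \<subseteq> V" for x using in_V symD by blast
  have fin: "finite (?N x)" for x using finite_subset[OF N_V finite_V] .
  have "Max ((\<lambda>x. card (?N x)) ` V) \<in> (\<lambda>x. card (?N x)) ` V"
    using finite_V card_V by (intro Max_in) auto
  then obtain v where v: "v \<in> V" "card (?N v) = Max ((\<lambda>x. card (?N x)) ` V)" by auto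
  define d where "d = card (?N v)"
  have le_d: "card (?N x) \<le> d" for x
  proof (cases "x \<in> V")
    case True
    then show ?thesis unfolding d_def v(2) using finite_V by simp
  next
    case False
    then have "?N x = {}" using in_V by blast
    then show ?thesis by simp
  qed
  have "3 \<le> d" using ex_degree_ge_3 card_V le_d order_trans by fastforce
  obtain m c where c: "odd m" "7 \<le> m" "inj_on c {..<m}"
    "\<And>i j. i < m \<Longrightarrow> j < m \<Longrightarrow> E (c i) (c j) \<longleftrightarrow> j = Suc i mod m \<or> i = Suc j mod m"
    "c ` {..<m} \<subseteq> V - insert v (?N v)"
    "\<And>i a. m = 7 \<Longrightarrow> i \<in> {1, 3, 5, 6} \<Longrightarrow> E v a \<Longrightarrow> \<not> E (c i) a"
    by (rule rotated_odd_cycle_avoiding[of v]) blast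
  have c_not: "c i \<in> V" "c i \<noteq> v" "\<not> E v (c i)" if "i < m" for i
    using c(5) that by auto
  obtain as where as: "set as = ?N v" "distinct as"
    using finite_distinct_list[OF fin] by blast
  have len_as: "length as = d" using as distinct_card unfolding d_def by metis
  obtain ws where ws: "set ws = V - c ` {..<m} - insert v (?N v)" "distinct ws"
    using finite_distinct_list[of "V - c ` {..<m} - insert v (?N v)"] finite_V by blast
  \<comment> \<open>The labelling of the configurations: cycle, \<open>v\<close>, its neighbours,
    all others. Its length 14 gives the bound on \<open>m + d\<close>.\<close>
  define L where "L = map c [0..<m] @ v # as @ ws"
  have "distinct L"
    using as ws c(3,5) irrefl by (auto simp: L_def distinct_map lessThan_atLeast0)
  have set_L: "set L = V"
    using as ws c(5) N_V[of v] v(1) by (auto simp: L_def lessThan_atLeast0)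
  have len_L: "length L = 14"
    using distinct_card[OF \<open>distinct L\<close>] set_L card_V by simp
  have bound: "m + d \<le> 13" using len_L by (simp add: L_def len_as)
  have L_c: "L ! i = c i" if "i < m" for i using that by (simp add: L_def nth_append)
  have L_v: "L ! m = v" by (simp add: L_def nth_append)
  have L_a: "L ! j = as ! (j - Suc m)" if "m < j" "j \<le> m + d" for j
    using that by (auto simp: L_def nth_append len_as nth_Cons')
  \<comment> \<open>The range conditions confine \<open>F\<close> to valid positions of
    \<open>L\<close>, where labels and vertices determine each other.\<close>
  define F where "F i j \<longleftrightarrow> i < 14 \<and> j < 14 \<and> E (L ! i) (L ! j)" for i j
  have F_walk: "(E ^^ n) (L ! i) (L ! j)" if "(F ^^ n) i j" for n i j
    by (rule relpowp_map[of F E, OF _ that]) (simp add: F_def)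
  have nth_eq: "L ! i = L ! j \<longleftrightarrow> i = j" if "i < 14" "j < 14" for i j
    using nth_eq_iff_index_eq[OF \<open>distinct L\<close>] that len_L by simp
  interpret labelled_obstruction F m d
  proof
    show F_sym: "F i j \<longleftrightarrow> F j i" for i j using symD unfolding F_def by blast
    show "\<not> successively F (p @ [hd p])" if p: "length p \<in> {1, 3, 5}" for p
    proof
      assume "successively F (p @ [hd p])"
      then obtain x xs where "p = x # xs" "successively F (x # xs @ [x])"
        using p by (cases p) auto
      then have "(F ^^ length p) x x" using successively_relpowp by fastforce
      then show False using F_walk no_short[OF p] by blast
    qed
    show "\<not> list_all (F i) js" if "distinct js" "d < length js" for i js
    proof
      assume js: "list_all (F i) js"
      have "inj_on ((!) L) (set js)"
        using js nth_eq by (auto simp: list_all_iff F_def inj_on_def)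
      then have "card ((!) L ` set js) = length js"
        using that(1) by (simp add: card_image distinct_card)
      moreover have "(!) L ` set js \<subseteq> ?N (L ! i)"
        using js by (auto simp: list_all_iff F_def)
      ultimately have "length js \<le> card (?N (L ! i))"
        using card_mono[OF fin] by metis
      then show False using le_d[of "L ! i"] that(2) by simp
    qed
    show "\<not> sorted_wrt (\<lambda>(i, a) (j, b). F i j \<longrightarrow> C5_adj a b) (zip [0..<14] cs)"
      if cs: "length cs = 14" for cs
    proof
      assume "sorted_wrt (\<lambda>(i, a) (j, b). F i j \<longrightarrow> C5_adj a b) (zip [0..<14] cs)"
      then have adj: "C5_adj (cs ! i) (cs ! j)" if "i < j" "j < 14" "F i j" for i j
        using cs that by (auto simp: sorted_wrt_iff_nth_less)
      \<comment> \<open>A colouring of labels is carried back to vertices. Outside \<open>V\<close>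
        the value is unspecified, which is harmless because no edge ends there.\<close>
      define h where "h x = cs ! (THE i. i < 14 \<and> L ! i = x)" for x
      have h: "h (L ! i) = cs ! i" if "i < 14" for i
        unfolding h_def using that nth_eq by (intro arg_cong[of _ _ "(!) cs"] the_equality) auto
      have "C5_adj (h x) (h y)" if "E x y" for x y
      proof -
        have "x \<in> set L" "y \<in> set L" using that in_V symD set_L by auto
        then obtain i j where ij: "i < 14" "j < 14" "x = L ! i" "y = L ! j"
          using len_L by (metis in_set_conv_nth)
        then have "F i j" "F j i" "i \<noteq> j" using that symD irrefl by (auto simp: F_def)
        then have "C5_adj (cs ! i) (cs ! j)"
          using adj[of i j] adj[of j i] ij C5_adj_sym by (cases i j rule: linorder_cases) auto
        then show ?thesis using ij h by simp
      qed
      then show False using not_colourable unfolding C5_colourable_def by blast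
    qed
    show "F i j \<longleftrightarrow> j = Suc i mod m \<or> i = Suc j mod m" if "i < m" "j < m" for i j
      using c(4) that L_c bound by (simp add: F_def)
    show star: "F m j \<longleftrightarrow> m < j \<and> j \<le> m + d" for j
    proof
      assume "F m j"
      then have j: "j < 14" "L ! j \<in> ?N v" by (auto simp: F_def L_v)
      then obtain k where k: "k < d" "L ! j = as ! k"
        using as(1) len_as by (metis in_set_conv_nth)
      then have "L ! j = L ! (Suc m + k)" using L_a[of "Suc m + k"] by simp
      then have "j = Suc m + k" using nth_eq[of j "Suc m + k"] j k bound by simp
      then show "m < j \<and> j \<le> m + d" using k by simp
    next
      assume j: "m < j \<and> j \<le> m + d"
      then have "j - Suc m < length as" using len_as by linarith
      then have "as ! (j - Suc m) \<in> set as" by (rule nth_mem)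
      then have "L ! j \<in> ?N v" using L_a[of j] as(1) j by simp
      then show "F m j" using j bound by (simp add: F_def L_v)
    qed
    show "\<not> F i j" if "m = 7" "i \<in> {1, 3, 5, 6}" "m < j" "j \<le> m + d" for i j
    proof -
      have "F m j" using star that by blast
      then have "E v (L ! j)" by (simp add: F_def L_v)
      then have "\<not> E (c i) (L ! j)" using c(6) that by blast
      then show ?thesis using L_c[of i] that by (auto simp: F_def)
    qed
  qed
  \<comment> \<open>\<open>3 <= d\<close> leaves \<open>m <= 10\<close>, and \<open>m\<close> is odd
    and at least 7.\<close>
  have "m = 7 \<or> m = 9" using c(1,2) bound \<open>3 \<le> d\<close> by presburger
  then consider "m = 7" "d = 3" | "m = 7" "d = 4" | "m = 7" "d = 5" | "m = 7" "d = 6"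
    | "m = 9" "d = 3" | "m = 9" "d = 4"
    using bound \<open>3 \<le> d\<close> by linarith
  then show False
    by cases (fact no_cycle_7_degree_3 no_cycle_7_degree_4 no_cycle_7_degree_5
      no_cycle_7_degree_6 no_cycle_9_degree_3 no_cycle_9_degree_4)+
qed

end

section \<open>Odd girth and the graph on 15 vertices\<close>

lemma pcas_relpowp:
  "pcas u p v \<Longrightarrow> set p \<subseteq> A \<Longrightarrow> ((\<lambda>x y. (x, y) \<in> A) ^^ length p) u v"
proof (induction p arbitrary: u)
  case (Cons e p)
  then have "(u, snd e) \<in> A" "((\<lambda>x y. (x, y) \<in> A) ^^ length p) (snd e) v" by auto
  then show ?case by (simp only: list.size add_Suc_right add_0_right relpowp_Suc_I2)
qed simp

lemma pcas_map_upt: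
  "i \<le> j \<Longrightarrow> pcas (f i) (map (\<lambda>i. (f i, f (Suc i))) [i..<j]) (f j)"
  by (induction i rule: inc_induct) (simp_all add: upt_conv_Cons)

context pair_graph
begin

lemma symp_parcs: "symp (\<lambda>x y. (x, y) \<in> parcs G)"
  using arcs_symmetric by (auto intro: sympI)

text \<open>\<open>odd_girth\<close> speaks of cycles, but a shortest odd closed walk of the graph
  has no repeated vertex, so it is a cycle, and it is no longer than the given walk.\<close>

lemma odd_girth_le_closed_walk:
  assumes n: "odd n" "((\<lambda>x y. (x, y) \<in> parcs G) ^^ n) x x"
  shows "odd_girth G \<le> enat n"
proof -
  obtain m c where c: "odd m" "inj_on c {..<m}"
    "\<And>i j. i < m \<Longrightarrow> j < m \<Longrightarrow> (c i, c j) \<in> parcs G \<longleftrightarrow> j = Suc i mod m \<or> i = Suc j mod m"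
    "\<And>n x. odd n \<Longrightarrow> ((\<lambda>x y. (x, y) \<in> parcs G) ^^ n) x x \<Longrightarrow> m \<le> n"
    by (rule chordless_odd_cycle[OF symp_parcs]) (use n in blast)+
  then have "0 < m" by (auto intro: Nat.gr0I)
  \<comment> \<open>The periodic extension of \<open>c\<close> gives the closing arc the same form
    as the others.\<close>
  define f where "f i = c (i mod m)" for i
  define p where "p = map (\<lambda>i. (f i, f (Suc i))) [0..<m]"
  have arcs: "(f i, f (Suc i)) \<in> parcs G" for i
    using c(3)[of "i mod m" "Suc i mod m"] \<open>0 < m\<close> by (simp add: f_def mod_Suc_eq)
  have cas: "pcas (f 0) p (f 0)"
    using pcas_map_upt[of 0 m f] by (simp add: p_def f_def)
  \<comment> \<open>The definition of a cycle asks for distinctness of the visited vertices without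
    the first one, that is, of \<open>f 1\<close> up to \<open>f m\<close>.\<close>
  have "inj_on (\<lambda>i. f (Suc i)) {0..<m}"
  proof (rule inj_onI)
    fix i j assume ij: "i \<in> {0..<m}" "j \<in> {0..<m}" "f (Suc i) = f (Suc j)"
    then have "Suc i mod m = Suc j mod m"
      using inj_onD[OF c(2)] \<open>0 < m\<close> by (simp add: f_def)
    then show "i = j" using mod_add_right_cancel_nat[of i 1 m j] ij by simp
  qed
  then have "distinct (map snd p)" by (simp add: p_def comp_def distinct_map)
  moreover have "pre_digraph.awalk_verts (with_proj G) (f 0) p = fst (hd p) # map snd p"
    using pre_digraph.awalk_verts_conv'[of "with_proj G" "f 0" p "f 0"] cas \<open>0 < m\<close>
    by (simp add: p_def)
  moreover have "pre_digraph.awalk (with_proj G) (f 0) p (f 0)"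
    using cas arcs arcs[of 0, THEN in_arcsD1] by (auto simp: pre_digraph.awalk_def p_def)
  ultimately have "pre_digraph.cycle (with_proj G) p"
    using \<open>0 < m\<close> unfolding pre_digraph.cycle_def by (auto simp: p_def)
  then have "odd_girth G \<le> enat (length p)"
    unfolding odd_girth_def using c(1) by (intro Inf_lower CollectI exI[of _ p]) (simp add: p_def)
  also have "\<dots> \<le> enat n" using c(4)[OF n] by (simp add: p_def)
  finally show ?thesis .
qed

lemma odd_girth_geI:
  assumes "\<And>n x. odd n \<Longrightarrow> ((\<lambda>x y. (x, y) \<in> parcs G) ^^ n) x x \<Longrightarrow> k \<le> n"
  shows "enat k \<le> odd_girth G"
  unfolding odd_girth_def
proof (rule Inf_greatest)
  fix l assume "l \<in> {enat (length p) |p. pre_digraph.cycle (with_proj G) p \<and> odd (length p)}"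
  then obtain p u where p: "l = enat (length p)" "odd (length p)" "pcas u p u" "set p \<subseteq> parcs G"
    by (auto simp: pre_digraph.cycle_def pre_digraph.awalk_def)
  then show "enat k \<le> l" using assms[OF p(2) pcas_relpowp[OF p(3,4)]] by simp
qed

text \<open>The graph is first moved to the natural numbers, because its own vertex type may have
  fewer than 14 elements and then offers no room for isolated vertices as padding.\<close>

lemma admits_hom_C5:
  assumes card: "card (pverts G) \<le> 14" and girth: "7 \<le> odd_girth G"
  shows "admits_hom G (cycle_graph 5)"
proof -
  let ?A = "\<lambda>x y. (x, y) \<in> parcs G"
  obtain g where g: "bij_betw g (pverts G) {0..<card (pverts G)}"
    using ex_bij_betw_finite_nat[OF finite_verts] by auto
  define E where "E i j \<longleftrightarrow> (\<exists>x y. ?A x y \<and> i = g x \<and> j = g y)" for i j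
  have "C5_colourable E"
  proof (rule ccontr)
    assume "\<not> C5_colourable E"
    then interpret non_C5_colourable E "{..<14}"
    proof unfold_locales
      show "symp E" using symp_parcs unfolding E_def by (auto intro!: sympI dest: sympD)
      show "\<not> (E ^^ n) i i" if n: "n \<in> {1, 3, 5}" for n i
      proof
        assume "(E ^^ n) i i"
        \<comment> \<open>The inverse of the numbering maps edges to edges, so short odd closed
          walks of \<open>E\<close> pull back to the graph.\<close>
        moreover have "?A (inv_into (pverts G) g i) (inv_into (pverts G) g j)" if "E i j" for i j
        proof -
          obtain x y where xy: "?A x y" "i = g x" "j = g y" using \<open>E i j\<close> E_def by blast
          then show ?thesis
            using inv_into_f_f[OF bij_betw_imp_inj_on[OF g]] in_arcsD1 in_arcsD2 by metis
        qed
        ultimately have "(?A ^^ n) (inv_into (pverts G) g i) (inv_into (pverts G) g i)"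
          using relpowp_map[of E ?A] by blast
        then have "odd_girth G \<le> enat n" using odd_girth_le_closed_walk n by auto
        then have "7 \<le> enat n" using girth by (rule order_trans[rotated])
        then show False using n by (auto simp: numeral_eq_enat one_enat_def)
      qed
      show "i \<in> {..<14}" if "E i j" for i j
      proof -
        obtain x where "x \<in> pverts G" "i = g x" using \<open>E i j\<close> in_arcsD1 E_def by blast
        then show ?thesis using bij_betwE[OF g] card by auto
      qed
    qed auto
    show False using card_V_neq_14 by simp
  qed
  then obtain h where h: "\<And>i j. E i j \<Longrightarrow> C5_adj (h i) (h j)"
    unfolding C5_colourable_def by blast
  \<comment> \<open>The default 0 is reached only at isolated vertices, whose colour under
    \<open>h\<close> is arbitrary.\<close>
  have "graph_hom (\<lambda>x. if h (g x) < 5 then h (g x) else 0) G (cycle_graph 5)"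
    unfolding graph_hom_def
  proof safe
    fix x y assume "(x, y) \<in> parcs G"
    then have "C5_adj (h (g x)) (h (g y))" using h E_def by blast
    then show "(if h (g x) < 5 then h (g x) else 0, if h (g y) < 5 then h (g y) else 0)
      \<in> parcs (cycle_graph 5)"
      by (auto simp: C5_adj_def cycle_graph_def)
  qed (simp add: cycle_graph_def)
  then show ?thesis unfolding admits_hom_def by blast
qed

end

text \<open>A subdivision of the Wagner graph (the Moebius ladder on 8 vertices). The rim is the
  10-cycle 2, 3, 4, 5, 6, 0, 13, 10, 7, 9, and the rungs are the paths 0-1-2, 3-12-13, 5-8-7 and
  6-14-11-9. The labels 0 to 6 form a 7-cycle.\<close>

definition edges15 :: "(nat \<times> nat) list" where
  "edges15 = [(0,1), (1,2), (2,3), (3,4), (4,5), (5,6), (6,0), (0,13), (2,9), (3,12), (5,8),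
     (6,14), (7,8), (7,9), (7,10), (9,11), (10,13), (11,14), (12,13)]"

definition arcs15 :: "(nat \<times> nat) list" where
  "arcs15 = edges15 @ map prod.swap edges15"

definition graph15 :: "nat pair_pre_digraph" where
  "graph15 = \<lparr>pverts = {0..<15}, parcs = set arcs15\<rparr>"

interpretation graph15: pair_graph graph15
proof
  show "symmetric (with_proj graph15)"
    by (auto simp: symmetric_def graph15_def arcs15_def intro!: symI)
qed (auto simp: graph15_def arcs15_def edges15_def)

definition succs15 :: "nat \<Rightarrow> nat list" where
  "succs15 x = map snd (filter (\<lambda>e. fst e = x) arcs15)"

text \<open>Iterated successor lists are computable and over-approximate the endpoints of walks, so
  a vertex missing from its own list has no closed walk of that length.\<close>

lemma succs15_relpowp:
  assumes "((\<lambda>x y. (x, y) \<in> parcs graph15) ^^ n) x y"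
  shows "y \<in> set (((\<lambda>xs. remdups (concat (map succs15 xs))) ^^ n) [x])"
  using assms
proof (induction n arbitrary: y)
  case (Suc n)
  then obtain z where "z \<in> set (((\<lambda>xs. remdups (concat (map succs15 xs))) ^^ n) [x])"
    "(z, y) \<in> parcs graph15"
    by auto
  moreover from this(2) have "y \<in> set (succs15 z)" by (force simp: succs15_def graph15_def)
  ultimately show ?case by auto
qed simp

lemma odd_girth_graph15: "odd_girth graph15 = 7"
proof (rule antisym)
  let ?A = "\<lambda>x y. (x, y) \<in> parcs graph15"
  have "successively ?A (0 # [1, 2, 3, 4, 5, 6] @ [0])"
    by (simp add: graph15_def arcs15_def edges15_def)
  then have "(?A ^^ Suc (length [1, 2, 3, 4, 5, 6 :: nat])) 0 0" by (rule successively_relpowp)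
  moreover have "Suc (length [1, 2, 3, 4, 5, 6 :: nat]) = 7" by simp
  ultimately have "(?A ^^ 7) 0 0" by (simp only:)
  then have "odd_girth graph15 \<le> enat 7" by (intro graph15.odd_girth_le_closed_walk) simp
  then show "odd_girth graph15 \<le> 7" by (simp add: numeral_eq_enat)
  have "list_all (\<lambda>n. list_all
    (\<lambda>x. x \<notin> set (((\<lambda>xs. remdups (concat (map succs15 xs))) ^^ n) [x])) [0..<15])
    [1, 3, 5]"
    by code_simp
  then have no_walk: "\<not> (?A ^^ n) x x" if "n \<in> {1, 3, 5}" "x < 15" for n x
    using that succs15_relpowp[of n x x] by (auto simp: list_all_iff)
  have "enat 7 \<le> odd_girth graph15"
  proof (rule graph15.odd_girth_geI)
    fix n x assume n: "odd n" "(?A ^^ n) x x"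
    then have "0 < n" by (auto intro: Nat.gr0I)
    then obtain k where "n = Suc k" using gr0_implies_Suc by blast
    then obtain y where "?A x y" using n(2) relpowp_Suc_D2 by fast
    \<comment> \<open>The computation covers only the 15 vertices; a closed walk of positive length
      starts with an arc and hence at one of them.\<close>
    then have "x \<in> pverts graph15" by (rule graph15.in_arcsD1)
    then have "x < 15" by (simp add: graph15_def)
    then have "n \<notin> {1, 3, 5}" using no_walk n(2) by blast
    then show "7 \<le> n" using n(1) by simp presburger
  qed
  then show "7 \<le> odd_girth graph15" by (simp add: numeral_eq_enat)
qed

text \<open>A propositional encoding of colours in which \<open>a = 0\<close> to
  \<open>a = 4\<close> act as atoms. The solver sees no relation between them, so mutual exclusion
  has to be stated. As arcs occur in both orientations, clauses for the source of each arc reach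
  every vertex.\<close>

lemma C5_adj_clauses:
  assumes "C5_adj a b"
  shows "(a = 0 \<or> a = 1 \<or> a = 2 \<or> a = 3 \<or> a = 4) \<and>
    (a = 0 \<longrightarrow> b = 1 \<or> b = 4) \<and> (a = 1 \<longrightarrow> b = 0 \<or> b = 2) \<and> (a = 2 \<longrightarrow> b = 1 \<or> b = 3) \<and>
    (a = 3 \<longrightarrow> b = 2 \<or> b = 4) \<and> (a = 4 \<longrightarrow> b = 0 \<or> b = 3) \<and>
    (a = 0 \<longrightarrow> a \<noteq> 1 \<and> a \<noteq> 2 \<and> a \<noteq> 3 \<and> a \<noteq> 4) \<and> (a = 1 \<longrightarrow> a \<noteq> 2 \<and> a \<noteq> 3 \<and> a \<noteq> 4) \<and>
    (a = 2 \<longrightarrow> a \<noteq> 3 \<and> a \<noteq> 4) \<and> (a = 3 \<longrightarrow> a \<noteq> 4)"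
proof -
  have "a = 0 \<or> a = 1 \<or> a = 2 \<or> a = 3 \<or> a = 4" "b = 0 \<or> b = 1 \<or> b = 2 \<or> b = 3 \<or> b = 4"
    using assms by (auto simp: C5_adj_iff)
  then show ?thesis using assms by (elim disjE) (simp_all add: C5_adj_iff)
qed

lemma graph15_no_hom: "\<not> admits_hom graph15 (cycle_graph 5)"
proof
  assume "admits_hom graph15 (cycle_graph 5)"
  then obtain h where "\<forall>(u, v) \<in> set arcs15. C5_adj (h u) (h v)"
    unfolding admits_hom_def graph_hom_def C5_adj_def graph15_def by auto
  then have "\<forall>e \<in> set arcs15. C5_adj (h (fst e)) (h (snd e))" by auto
  then show False
    unfolding arcs15_def edges15_def
    by (simp only: list.map swap_simp append_Cons append_Nil list.set ball_simps fst_conv snd_conv)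
      (elim conjE, (drule C5_adj_clauses)+, sat)
qed

theorem theorem10:
  shows "(\<forall>G :: 'a pair_pre_digraph.
            pair_graph G \<and> card (pverts G) \<le> 14 \<and> 7 \<le> odd_girth G
              \<longrightarrow> admits_hom G (cycle_graph 5))
         \<and> eta 3 2 = 15"
proof (intro conjI allI impI)
  fix G :: "'a pair_pre_digraph"
  assume "pair_graph G \<and> card (pverts G) \<le> 14 \<and> 7 \<le> odd_girth G"
  then show "admits_hom G (cycle_graph 5)" using pair_graph.admits_hom_C5 by blast
next
  let ?S = "{enat (card (pverts G)) | G :: nat pair_pre_digraph.
    pair_graph G \<and> odd_girth G = enat 7 \<and> \<not> admits_hom G (cycle_graph 5)}"
  have "Inf ?S = 15"
  proof (rule antisym)
    have "15 = enat (card (pverts graph15))" by (simp add: graph15_def numeral_eq_enat)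
    then show "Inf ?S \<le> 15"
      \<comment> \<open>The value 15 is attained by \<open>graph15\<close>; the other inequality is
        the first claim, applied to graphs on natural numbers.\<close>
      using graph15.pair_graph odd_girth_graph15 graph15_no_hom
      by (intro Inf_lower) (auto simp: numeral_eq_enat)
    show "15 \<le> Inf ?S"
    proof (rule Inf_greatest)
      fix k assume "k \<in> ?S"
      then obtain G :: "nat pair_pre_digraph" where G: "k = enat (card (pverts G))" "pair_graph G"
        "odd_girth G = enat 7" "\<not> admits_hom G (cycle_graph 5)" by auto
      then have "\<not> card (pverts G) \<le> 14"
        using pair_graph.admits_hom_C5[of G] by (auto simp: numeral_eq_enat)
      then show "15 \<le> k" using G(1) by (simp add: numeral_eq_enat)
    qed
  qed
  then show "eta 3 2 = 15" unfolding eta_def by simp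
qed

end
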